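(* Let $(X,\tau)$ be a Hausdorff topological space in which every $\omega$-cover has a countable subset that is an $\omega$-cover. Then the following statements are equivalent: (1) $\textsf{S}_1(\Omega,\Omega)$; (2) ${\sf E}(\Omega,\Omega)$; (3) ${\sf GP}(\Omega,\Omega)$; (4) ${\sf FG}(\Omega,\Omega)$; (5) ${\sf NW}(\Omega,\Omega)$; (6) for all positive integers $n$ and $k$, $\Omega\rightarrow(\Omega)^n_k$; (7) for all positive integers $n$ and $k$, $\Omega\rightarrow[\Omega]^n_{k/\le 2}$; (8) $\Omega\rightarrow[\Omega]^2_{3}$ (that is, $\Omega\rightarrow[\Omega]^2_{3/\le 2}$); (9) $\Omega\rightarrow(\Omega,4)^3$; (10) $\Omega\rightarrow(\Omega)^2_2$; (11) $\Omega\rightarrow(\Omega,\mathcal{O})^2$.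
   Context: An open cover $\mathcal{U}$ of $X$ is an $\omega$-cover if $X\notin\mathcal{U}$ and every finite subset of $X$ is contained in some member of $\mathcal{U}$; $\Omega$ is the set of $\omega$-covers of $X$ and $\mathcal{O}$ the set of open covers of $X$. For families $\mathcal{A},\mathcal{B}$, $\textsf{S}_1(\mathcal{A},\mathcal{B})$ means: for every sequence $(O_n:n\in\mathbb{N})$ of elements of $\mathcal{A}$ there are $T_n\in O_n$ with $\{T_n:n\in\mathbb{N}\}\in\mathcal{B}$. For a set $S$, $[S]^m$ is the set of $m$-element subsets, $[S]^{<\aleph_0}$ the finite subsets, $[S]^{\aleph_0}$ the countably infinite subsets. Partition relations: $\mathcal{A}\rightarrow(\mathcal{B})^m_k$ means for each $A\in\mathcal{A}$ and each $f:[A]^m\to\{1,\dots,k\}$ there are $i$ and $B\subseteq A$, $B\in\mathcal{B}$, with $f$ constant equal to $i$ on $[B]^m$. $\mathcal{A}\rightarrow(\mathcal{B}_1,\mathcal{B}_2)^m$ means for each $A\in\mathcal{A}$ and $f:[A]^m\to\{1,2\}$ there are $i\in\{1,2\}$ and $B\subseteq A$ with $B\in\mathcal{B}_i$ and $f$ constant equal to $i$ on $[B]^m$; in $\Omega\rightarrow(\Omega,4)^3$ the second family is the family of $4$-element sets, and in $\Omega\rightarrow(\Omega,\mathcal{O})^2$ it is $\mathcal{O}$. $\mathcal{A}\rightarrow[\mathcal{B}]^m_{k/\le\ell}$ means for each $A\in\mathcal{A}$ and $f:[A]^m\to\{1,\dots,k\}$ there is $B\subseteq A$, $B\in\mathcal{B}$,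 with $|f[[B]^m]|\le\ell$; $\mathcal{A}\rightarrow[\mathcal{B}]^m_k$ abbreviates $\mathcal{A}\rightarrow[\mathcal{B}]^m_{k/\le k-1}$. For a countably infinite set $A$ with a fixed bijective enumeration $(a_n:n\in\mathbb{N})$: for nonempty $s,T\subseteq A$, $s<T$ means $a_n\in s$, $a_m\in T$ imply $n<m$; for finite $s$ and infinite $B$, $s<B$ means $s=\emptyset$ or $\max s<\min B$; $[s,B]=\{s\cup C\in[A]^{\aleph_0}: s<C\subseteq B\}$. These sets form a basis of the Ellentuck topology on $[A]^{\aleph_0}$; subsets carry the subspace topology. For $B\subseteq A$ and finite $s$, $B|s=\{a_n\in B: s<\{a_n\}\}$. A finite $s\subseteq C$ is an initial segment of $C$ if $s<C\setminus s$. A set has the Baire property if it is of the form $(U\setminus M)\cup(M\setminus U)$ with $U$ open and $M$ meager. ${\sf E}(\Omega,\Omega)$: for each countably infinite $A\in\Omega$ and each $R\subseteq[A]^{\aleph_0}\cap\Omega$ having the Baire property in the Ellentuck topology on $[A]^{\aleph_0}\cap\Omega$, for each $S\subseteq A$ with $S\in\Omega$ and each finite $s\subseteq A$ there is an infinite $B\subseteq S|s$ with $B\in\Omega$ such that $[s,B]\cap\Omega\subseteq R$ or $[s,B]\cap\Omega\cap R=\emptyset$. ${\sf GP}(\Omega,\Omega)$: for each countably infinite $A\in\Omega$ and each $R\subseteq[A]^{\aleph_0}\cap\Omega$ that is open in the topology on $[A]^{\aleph_0}\cap\Omega$ inherited from $2^A$ (identifying sets with characteristic functions), for each $S\in[A]^{\aleph_0}\cap\Omega$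 there is $B\in[S]^{\aleph_0}\cap\Omega$ with $[B]^{\aleph_0}\cap\Omega\subseteq R$ or $[B]^{\aleph_0}\cap\Omega\cap R=\emptyset$. A family $\mathcal{S}\subseteq[A]^{<\aleph_0}$ is dense if $\mathcal{S}\cap[B]^{<\aleph_0}\neq\emptyset$ for every $B\in[A]^{\aleph_0}\cap\Omega$, and thin if no element of $\mathcal{S}$ is an initial segment of another. ${\sf FG}(\Omega,\Omega)$: for each countably infinite $A\in\Omega$ and each dense $\mathcal{S}\subseteq[A]^{<\aleph_0}$ there is $B\in[A]^{\aleph_0}\cap\Omega$ such that every $C\in[B]^{\aleph_0}\cap\Omega$ has an initial segment in $\mathcal{S}$. ${\sf NW}(\Omega,\Omega)$: for each countably infinite $A\in\Omega$, each thin $\mathcal{T}\subseteq[A]^{<\aleph_0}$, each $n$ and each partition $\mathcal{T}=\mathcal{T}_1\cup\dots\cup\mathcal{T}_n$ there are $B\in[A]^{\aleph_0}\cap\Omega$ and $i$ with $[B]^{<\aleph_0}\cap\mathcal{T}\subseteq\mathcal{T}_i$. *)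

theory Defs
  imports "HOL-Analysis.Analysis" "HOL-Library.Ramsey"
begin

definition open_covers :: "'a topology \<Rightarrow> 'a set set set" where
  "open_covers X = {U. (\<forall>V\<in>U. openin X V) \<and> \<Union>U = topspace X}"

definition omega_covers :: "'a topology \<Rightarrow> 'a set set set" where
  "omega_covers X = {U. (\<forall>V\<in>U. openin X V) \<and> \<Union>U = topspace X \<and> topspace X \<notin> U \<and>
      (\<forall>F. finite F \<and> F \<subseteq> topspace X \<longrightarrow> (\<exists>V\<in>U. F \<subseteq> V))}"

definition S1 :: "'b set set \<Rightarrow> 'b set set \<Rightarrow> bool" where
  "S1 \<A> \<B> \<longleftrightarrow> (\<forall>Us. (\<forall>n::nat. Us n \<in> \<A>) \<longrightarrow> (\<exists>T. (\<forall>n. T n \<in> Us n) \<and> range T \<in> \<B>))"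

definition ctbl_inf_subsets :: "'b set \<Rightarrow> 'b set set" where
  "ctbl_inf_subsets A = {C. C \<subseteq> A \<and> countable C \<and> infinite C}"

definition finite_subsets :: "'b set \<Rightarrow> 'b set set" where
  "finite_subsets A = {s. s \<subseteq> A \<and> finite s}"

definition arrow_hom :: "'b set set \<Rightarrow> 'b set set \<Rightarrow> nat \<Rightarrow> nat \<Rightarrow> bool" where
  "arrow_hom \<A> \<B> m k \<longleftrightarrow> (\<forall>A\<in>\<A>. \<forall>f. (\<forall>Y\<in>[A]\<^bsup>m\<^esup>. f Y \<in> {1..k}) \<longrightarrow>
      (\<exists>i\<in>{1..k}. \<exists>B. B \<subseteq> A \<and> B \<in> \<B> \<and> (\<forall>Y\<in>[B]\<^bsup>m\<^esup>. f Y = i)))"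

definition arrow_two :: "'b set set \<Rightarrow> 'b set set \<Rightarrow> 'b set set \<Rightarrow> nat \<Rightarrow> bool" where
  "arrow_two \<A> \<B>1 \<B>2 m \<longleftrightarrow> (\<forall>A\<in>\<A>. \<forall>f. (\<forall>Y\<in>[A]\<^bsup>m\<^esup>. f Y \<in> {1::nat,2}) \<longrightarrow>
      (\<exists>B. B \<subseteq> A \<and> ((B \<in> \<B>1 \<and> (\<forall>Y\<in>[B]\<^bsup>m\<^esup>. f Y = 1)) \<or>
                       (B \<in> \<B>2 \<and> (\<forall>Y\<in>[B]\<^bsup>m\<^esup>. f Y = 2)))))"

definition arrow_sq :: "'b set set \<Rightarrow> 'b set set \<Rightarrow> nat \<Rightarrow> nat \<Rightarrow> nat \<Rightarrow> bool" where
  "arrow_sq \<A> \<B> m k l \<longleftrightarrow> (\<forall>A\<in>\<A>. \<forall>f. (\<forall>Y\<in>[A]\<^bsup>m\<^esup>. f Y \<in> {1..k}) \<longrightarrow>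
      (\<exists>B. B \<subseteq> A \<and> B \<in> \<B> \<and> card (f ` [B]\<^bsup>m\<^esup>) \<le> l))"

text \<open>\<open>enum A\<close> is the fixed bijective enumeration of the countably infinite set \<open>A\<close>;
  \<open>idx enum A x\<close> is the index of \<open>x\<close> in it.\<close>
definition idx :: "('b set \<Rightarrow> nat \<Rightarrow> 'b) \<Rightarrow> 'b set \<Rightarrow> 'b \<Rightarrow> nat" where
  "idx enum A x = inv_into UNIV (enum A) x"

definition seg_less :: "('b set \<Rightarrow> nat \<Rightarrow> 'b) \<Rightarrow> 'b set \<Rightarrow> 'b set \<Rightarrow> 'b set \<Rightarrow> bool" where
  "seg_less enum A s T \<longleftrightarrow> (\<forall>x\<in>s. \<forall>y\<in>T. idx enum A x < idx enum A y)"

definition ell_int :: "('b set \<Rightarrow> nat \<Rightarrow> 'b) \<Rightarrow> 'b set \<Rightarrow> 'b set \<Rightarrow> 'b set \<Rightarrow> 'b set set" where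
  "ell_int enum A s B = {s \<union> C | C. s \<union> C \<in> ctbl_inf_subsets A \<and> seg_less enum A s C \<and> C \<subseteq> B}"

definition ellentuck :: "('b set \<Rightarrow> nat \<Rightarrow> 'b) \<Rightarrow> 'b set \<Rightarrow> 'b set topology" where
  "ellentuck enum A = topology_generated_by
     {ell_int enum A s B | s B. finite s \<and> s \<subseteq> A \<and> B \<in> ctbl_inf_subsets A \<and>
                               (s = {} \<or> seg_less enum A s B)}"

definition restr :: "('b set \<Rightarrow> nat \<Rightarrow> 'b) \<Rightarrow> 'b set \<Rightarrow> 'b set \<Rightarrow> 'b set \<Rightarrow> 'b set" where
  "restr enum A B s = {a\<in>B. seg_less enum A s {a}}"

definition initial_segment :: "('b set \<Rightarrow> nat \<Rightarrow> 'b) \<Rightarrow> 'b set \<Rightarrow> 'b set \<Rightarrow> 'b set \<Rightarrow> bool" where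
  "initial_segment enum A s C \<longleftrightarrow> finite s \<and> s \<subseteq> C \<and> seg_less enum A s (C - s)"

definition thin :: "('b set \<Rightarrow> nat \<Rightarrow> 'b) \<Rightarrow> 'b set \<Rightarrow> 'b set set \<Rightarrow> bool" where
  "thin enum A \<T> \<longleftrightarrow> (\<forall>s\<in>\<T>. \<forall>t\<in>\<T>. s \<noteq> t \<longrightarrow> \<not> initial_segment enum A s t)"

definition nowhere_dense_in :: "'c topology \<Rightarrow> 'c set \<Rightarrow> bool" where
  "nowhere_dense_in T N \<longleftrightarrow> N \<subseteq> topspace T \<and> T interior_of (T closure_of N) = {}"

definition meager_in :: "'c topology \<Rightarrow> 'c set \<Rightarrow> bool" where
  "meager_in T M \<longleftrightarrow> (\<exists>\<F>. countable \<F> \<and> (\<forall>N\<in>\<F>. nowhere_dense_in T N) \<and> M = \<Union>\<F>)"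

definition baire_property_in :: "'c topology \<Rightarrow> 'c set \<Rightarrow> bool" where
  "baire_property_in T R \<longleftrightarrow> (\<exists>U M. openin T U \<and> meager_in T M \<and> R = (U - M) \<union> (M - U))"

text \<open>The topology of 2^A (product of discrete two-point spaces), on Pow A,
  generated by the cylinder sets {D \<subseteq> A. D \<inter> F = G}, F finite.\<close>
definition cantor_top :: "'b set \<Rightarrow> 'b set topology" where
  "cantor_top A = topology_generated_by
     {{D. D \<subseteq> A \<and> D \<inter> F = G} | F G. finite F \<and> F \<subseteq> A \<and> G \<subseteq> F}"

definition E_Omega :: "'a topology \<Rightarrow> ('a set set \<Rightarrow> nat \<Rightarrow> 'a set) \<Rightarrow> bool" where
  "E_Omega X enum \<longleftrightarrow> (\<forall>A\<in>omega_covers X. countable A \<and> infinite A \<longrightarrow>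
     (\<forall>R. R \<subseteq> ctbl_inf_subsets A \<inter> omega_covers X \<and>
          baire_property_in (subtopology (ellentuck enum A) (ctbl_inf_subsets A \<inter> omega_covers X)) R \<longrightarrow>
       (\<forall>S s. S \<subseteq> A \<and> S \<in> omega_covers X \<and> finite s \<and> s \<subseteq> A \<longrightarrow>
          (\<exists>B. infinite B \<and> B \<subseteq> restr enum A S s \<and> B \<in> omega_covers X \<and>
               (ell_int enum A s B \<inter> omega_covers X \<subseteq> R \<or>
                ell_int enum A s B \<inter> omega_covers X \<inter> R = {})))))"

definition GP_Omega :: "'a topology \<Rightarrow> bool" where
  "GP_Omega X \<longleftrightarrow> (\<forall>A\<in>omega_covers X. countable A \<and> infinite A \<longrightarrow>
     (\<forall>R. openin (subtopology (cantor_top A) (ctbl_inf_subsets A \<inter> omega_covers X)) R \<longrightarrow>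
       (\<forall>S\<in>ctbl_inf_subsets A \<inter> omega_covers X.
          (\<exists>B\<in>ctbl_inf_subsets S \<inter> omega_covers X.
               ctbl_inf_subsets B \<inter> omega_covers X \<subseteq> R \<or>
               ctbl_inf_subsets B \<inter> omega_covers X \<inter> R = {}))))"

definition dense_fam :: "'a topology \<Rightarrow> 'a set set \<Rightarrow> 'a set set set \<Rightarrow> bool" where
  "dense_fam X A \<S> \<longleftrightarrow> \<S> \<subseteq> finite_subsets A \<and>
     (\<forall>B\<in>ctbl_inf_subsets A \<inter> omega_covers X. \<S> \<inter> finite_subsets B \<noteq> {})"

definition FG_Omega :: "'a topology \<Rightarrow> ('a set set \<Rightarrow> nat \<Rightarrow> 'a set) \<Rightarrow> bool" where
  "FG_Omega X enum \<longleftrightarrow> (\<forall>A\<in>omega_covers X. countable A \<and> infinite A \<longrightarrow>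
     (\<forall>\<S>. dense_fam X A \<S> \<longrightarrow>
       (\<exists>B\<in>ctbl_inf_subsets A \<inter> omega_covers X.
          \<forall>C\<in>ctbl_inf_subsets B \<inter> omega_covers X. \<exists>s\<in>\<S>. initial_segment enum A s C)))"

text \<open>A partition T = T_1 \<union> ... \<union> T_n is given by a colouring c : T \<rightarrow> {1..n},
  T_i = {t \<in> T. c t = i}.\<close>
definition NW_Omega :: "'a topology \<Rightarrow> ('a set set \<Rightarrow> nat \<Rightarrow> 'a set) \<Rightarrow> bool" where
  "NW_Omega X enum \<longleftrightarrow> (\<forall>A\<in>omega_covers X. countable A \<and> infinite A \<longrightarrow>
     (\<forall>\<T> n c. \<T> \<subseteq> finite_subsets A \<and> thin enum A \<T> \<and> n \<ge> 1 \<and> (\<forall>t\<in>\<T>. c t \<in> {1..n::nat}) \<longrightarrow>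
       (\<exists>B\<in>ctbl_inf_subsets A \<inter> omega_covers X. \<exists>i\<in>{1..n}.
          \<forall>t\<in>finite_subsets B \<inter> \<T>. c t = i)))"

end

theory Submission
  imports Defs
begin

text \<open>
  The omega-covers contained in a countable omega-cover form a coideal: if \<open>B \<union> C\<close> is an omega-cover,
  so is \<open>B\<close> or \<open>C\<close>. Under \<open>S\<^sub>1(\<Omega>,\<Omega>)\<close> this coideal is selective. Indeed, a selection from a decreasing
  sequence is a pseudo-intersection of it; and given a partition into finite blocks, selecting from the
  covers by intersections of \<open>n + 1\<close> members out of distinct blocks yields a transversal. For selective
  coideals, combinatorial forcing and fusion give the local Ellentuck theorem, hence (2), and the
  Nash-Williams partition theorem (5).

  Conversely, given covers \<open>U n\<close> and an omega-cover \<open>{V n}\<close>, consider the omega-cover of all \<open>V n \<inter> u\<close>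
  with \<open>u \<in> U n\<close>. A subcover cannot live on finitely many levels \<open>n\<close>, so a suitable colouring of pairs
  or triples by their levels forces an omega-subcover meeting each level at most once, which is a
  selection.
\<close>

section \<open>Coideals on an indexed countable set\<close>

text \<open>Fusion asks for more than a pseudo-intersection: everything in \<open>D\<close> beyond
  \<open>x\<close> must already lie in \<open>U (\<iota> x)\<close>. A selected element meets this
  demand if it was chosen at a stage later than \<open>\<iota> x\<close>, so the selection is
  thinned until its indices outgrow those of all early choices. The thinning is a transversal of
  long index intervals; two chosen points may still sit in adjacent intervals, and a split by parity
  leaves a whole interval between them. Selectivity enters the Ramsey theory only through fusion,
  which serves to decide all stems, to propagate rejection and to avoid a meager set.

  In the converse direction, the factor \<open>V n\<close> is what keeps a subcover from sitting on
  finitely many levels: each of finitely many proper subsets misses a point, and some member of the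
  subcover contains all these points.\<close>

locale coideal =
  fixes \<iota> :: "'b \<Rightarrow> nat" and A :: "'b set" and H :: "'b set set"
  assumes inj: "inj_on \<iota> A"
    and carrier: "B \<in> H \<Longrightarrow> B \<subseteq> A"
    and infinite: "B \<in> H \<Longrightarrow> infinite B"
    and upward: "B \<in> H \<Longrightarrow> B \<subseteq> C \<Longrightarrow> C \<subseteq> A \<Longrightarrow> C \<in> H"
    and split: "B \<union> C \<in> H \<Longrightarrow> B \<in> H \<or> C \<in> H"
begin

definition above :: "'b set \<Rightarrow> 'b set \<Rightarrow> 'b set" where
  "above s B = {y\<in>B. \<forall>x\<in>s. \<iota> x < \<iota> y}"

text \<open>The basic Ellentuck set \<open>[s, B]\<close> relativised to \<open>H\<close>. Trimming
  by \<open>above s\<close> is built in, so a stem can be lengthened without adjusting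
  \<open>B\<close>.\<close>

definition ext :: "'b set \<Rightarrow> 'b set \<Rightarrow> 'b set set" where
  "ext s B = {Y\<in>H. s \<subseteq> Y \<and> Y - s \<subseteq> above s B}"

text \<open>Openness in the relative Ellentuck topology. The condition
  \<open>Y \<in> ext t Y\<close> says that \<open>t\<close> is an initial segment of
  \<open>Y\<close>, and \<open>ext t Y\<close> is the least basic set with stem \<open>t\<close>
  around \<open>Y\<close>, so only these neighbourhoods have to be tested.\<close>

definition copen :: "'b set set \<Rightarrow> bool" where
  "copen U \<longleftrightarrow> U \<subseteq> H \<and> (\<forall>Y\<in>U. \<exists>t. finite t \<and> Y \<in> ext t Y \<and> ext t Y \<subseteq> U)"

lemma Diff_finite:
  assumes "B \<in> H" "finite F" shows "B - F \<in> H"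
proof -
  have "(B \<inter> F) \<union> (B - F) \<in> H" using assms by (simp add: Un_Diff_Int Int_Diff_Un)
  then show ?thesis using split infinite assms(2) by blast
qed

lemma finite_not_above:
  assumes "finite s" shows "finite {x\<in>A. \<exists>y\<in>s. \<iota> x \<le> \<iota> y}"
proof (rule finite_imageD)
  have "\<iota> ` {x\<in>A. \<exists>y\<in>s. \<iota> x \<le> \<iota> y} \<subseteq> {..Max (\<iota> ` s)}"
    using assms by (auto intro: order_trans)
  then show "finite (\<iota> ` {x\<in>A. \<exists>y\<in>s. \<iota> x \<le> \<iota> y})" using finite_subset by blast
  show "inj_on \<iota> {x\<in>A. \<exists>y\<in>s. \<iota> x \<le> \<iota> y}" using inj by (auto simp: inj_on_def)
qed

lemma above_mem:
  assumes "B \<in> H" "finite s" shows "above s B \<in> H"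
proof -
  have "above s B = B - {x\<in>A. \<exists>y\<in>s. \<iota> x \<le> \<iota> y}"
    using carrier[OF assms(1)] by (auto simp: above_def not_le)
  then show ?thesis using Diff_finite[OF assms(1) finite_not_above[OF assms(2)]] by simp
qed

lemma above_subset: "above s B \<subseteq> B"
  by (auto simp: above_def)

lemma above_mono: "B \<subseteq> C \<Longrightarrow> above s B \<subseteq> above s C"
  by (auto simp: above_def)

lemma above_above: "above s (above s B) = above s B"
  by (auto simp: above_def)

lemma extD:
  assumes "Y \<in> ext s B"
  shows "Y \<in> H" "s \<subseteq> Y" "Y - s \<subseteq> B" "\<And>x y. x \<in> s \<Longrightarrow> y \<in> Y - s \<Longrightarrow> \<iota> x < \<iota> y"
  using assms by (auto simp: ext_def above_def)

lemma extI:
  assumes "Y \<in> H" "s \<subseteq> Y" "Y - s \<subseteq> B" "\<And>x y. x \<in> s \<Longrightarrow> y \<in> Y - s \<Longrightarrow> \<iota> x < \<iota> y"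
  shows "Y \<in> ext s B"
  using assms by (auto simp: ext_def above_def)

lemma ext_mono: "B \<subseteq> C \<Longrightarrow> ext s B \<subseteq> ext s C"
  using above_mono[of B C s] by (auto simp: ext_def)

lemma ext_above: "ext s (above s B) = ext s B"
  by (simp add: ext_def above_above)

lemma ext_self: "Y \<in> H \<Longrightarrow> Y \<in> ext s Y \<longleftrightarrow> s \<subseteq> Y \<and> (\<forall>x\<in>s. \<forall>y\<in>Y - s. \<iota> x < \<iota> y)"
  by (auto simp: ext_def above_def)

lemma ext_subset_ext: "Y \<in> ext s B \<Longrightarrow> ext s Y \<subseteq> ext s B"
  by (auto simp: ext_def above_def)

lemma mem_ext_self: "Y \<in> ext s B \<Longrightarrow> Y \<in> ext s Y"
  by (auto simp: ext_def above_def)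

lemma Un_above_mem_ext:
  assumes "B \<in> H" "finite s" "s \<subseteq> A"
  shows "s \<union> above s B \<in> ext s B"
proof -
  have "s \<union> above s B \<in> H"
    using upward[OF above_mem[OF assms(1,2)]] assms(3) carrier[OF assms(1)] above_subset by blast
  then show ?thesis by (auto simp: ext_def)
qed

lemma copen_ext: "finite s \<Longrightarrow> copen (ext s B)"
  unfolding copen_def
proof (intro conjI ballI exI[of _ s])
  show "ext s B \<subseteq> H" by (auto simp: ext_def)
qed (use mem_ext_self ext_subset_ext in auto)

text \<open>Two initial segments of \<open>Y\<close> are comparable, so \<open>s \<union> t\<close>
  is the longer one, and a longer stem gives a smaller neighbourhood. This yields closure of
  \<open>copen\<close> under intersection.\<close>

lemma ext_join:
  assumes "Y \<in> ext s Y" "Y \<in> ext t Y"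
  shows "Y \<in> ext (s \<union> t) Y" "ext (s \<union> t) Y \<subseteq> ext t Y"
proof -
  show "Y \<in> ext (s \<union> t) Y" using assms by (auto simp: ext_def above_def)
  have "\<iota> x < \<iota> y" if "x \<in> t" "y \<in> Z - t" "Z \<in> ext (s \<union> t) Y" for x y Z
  proof (cases "y \<in> s")
    case True
    then have "y \<in> Y - t" using that assms(1) by (auto simp: ext_def)
    then show ?thesis using that(1) assms(2) by (auto simp: ext_def above_def)
  next
    case False
    then show ?thesis using that by (auto simp: ext_def above_def)
  qed
  note less = this
  have sub: "s \<subseteq> Y" using assms(1) by (simp add: ext_def)
  show "ext (s \<union> t) Y \<subseteq> ext t Y"
  proof
    fix Z assume Z: "Z \<in> ext (s \<union> t) Y"
    then have "Z \<in> H" "t \<subseteq> Z" "Z - t \<subseteq> Y" using sub by (auto simp: ext_def above_def)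
    moreover have "\<forall>y\<in>Z - t. \<forall>x\<in>t. \<iota> x < \<iota> y" using less Z by blast
    ultimately show "Z \<in> ext t Y" unfolding ext_def above_def by blast
  qed
qed

lemma copen_Int:
  assumes "copen U" "copen V" shows "copen (U \<inter> V)"
  unfolding copen_def
proof (intro conjI ballI)
  show "U \<inter> V \<subseteq> H" using assms by (auto simp: copen_def)
  fix Y assume "Y \<in> U \<inter> V"
  then obtain s t where s: "finite s" "Y \<in> ext s Y" "ext s Y \<subseteq> U"
    and t: "finite t" "Y \<in> ext t Y" "ext t Y \<subseteq> V"
    using assms unfolding copen_def by (meson IntE)
  then show "\<exists>t. finite t \<and> Y \<in> ext t Y \<and> ext t Y \<subseteq> U \<inter> V"
    using ext_join[of Y s t] ext_join[of Y t s]
    by (intro exI[of _ "s \<union> t"]) (auto simp: Un_commute)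
qed

lemma copen_Union: "(\<And>U. U \<in> K \<Longrightarrow> copen U) \<Longrightarrow> copen (\<Union>K)"
  unfolding copen_def by (meson Sup_least Union_iff Union_upper subset_trans)

end

section \<open>Selective coideals and the local Ellentuck theorem\<close>

text \<open>\<open>diag\<close> is selectivity in diagonal form: it merges pseudo-intersections of
  decreasing sequences with the thinning needed to make the intersection hold beyond each point
  \<open>x\<close>.\<close>

locale selective_coideal = coideal \<iota> A H
  for \<iota> :: "'b \<Rightarrow> nat" and A H +
  assumes diag: "(\<And>n. U n \<in> H) \<Longrightarrow> decseq U \<Longrightarrow>
      \<exists>D\<in>H. D \<subseteq> U 0 \<and> (\<forall>x\<in>D. above {x} D \<subseteq> U (\<iota> x))"
begin

text \<open>Up to each index there are only finitely many stems, so a decreasing sequence can treat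
  all of them in turn, and \<open>diag\<close> gathers the stages into one set. The assumption
  \<open>tail\<close> lets \<open>P t\<close> ignore elements that do not lie above
  \<open>t\<close>.\<close>

lemma fusion:
  assumes S0: "S0 \<in> H" and s: "finite s" "s \<subseteq> A"
    and dense: "\<And>t S. finite t \<Longrightarrow> s \<subseteq> t \<Longrightarrow> t \<subseteq> s \<union> S0 \<Longrightarrow> S \<subseteq> S0 \<Longrightarrow> S \<in> H \<Longrightarrow>
        \<exists>S'\<in>H. S' \<subseteq> S \<and> P t S'"
    and hereditary: "\<And>t S S'. finite t \<Longrightarrow> P t S \<Longrightarrow> S' \<subseteq> S \<Longrightarrow> S' \<in> H \<Longrightarrow> P t S'"
    and tail: "\<And>t S. finite t \<Longrightarrow> S \<in> H \<Longrightarrow> P t (above t S) \<Longrightarrow> P t S"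
  shows "\<exists>D\<in>H. D \<subseteq> above s S0 \<and> (\<forall>t. finite t \<and> s \<subseteq> t \<and> t \<subseteq> s \<union> D \<longrightarrow> P t D)"
proof -
  have finite_step: "\<exists>S'\<in>H. S' \<subseteq> S \<and> (\<forall>t\<in>F. P t S')"
    if "finite F" "\<forall>t\<in>F. finite t \<and> s \<subseteq> t \<and> t \<subseteq> s \<union> S0" "S \<in> H" "S \<subseteq> S0" for F S
    using that
  proof (induction F arbitrary: S)
    case (insert t F)
    obtain S1 where S1: "S1 \<in> H" "S1 \<subseteq> S" "P t S1"
      using dense[of t S] insert.prems by auto
    obtain S2 where S2: "S2 \<in> H" "S2 \<subseteq> S1" "\<forall>t\<in>F. P t S2"
      using insert.IH[of S1] S1 insert.prems by auto
    have "P t S2" using hereditary[of t S1 S2] S1 S2 insert.prems by auto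
    then show ?case using S1 S2 by (intro bexI[of _ S2]) auto
  qed auto
  define F where "F n = {t. s \<subseteq> t \<and> t \<subseteq> s \<union> {x\<in>S0. \<iota> x \<le> n}}" for n
  have low: "finite (s \<union> {x\<in>S0. \<iota> x \<le> n})" for n
  proof -
    have "finite {x\<in>S0. \<iota> x \<le> n}"
    proof (rule finite_imageD)
      show "finite (\<iota> ` {x\<in>S0. \<iota> x \<le> n})" by (rule finite_subset[of _ "{..n}"]) auto
      show "inj_on \<iota> {x\<in>S0. \<iota> x \<le> n}" using inj carrier[OF S0] by (auto simp: inj_on_def)
    qed
    then show ?thesis using s by simp
  qed
  have finF: "finite (F n)" for n
    by (rule finite_subset[of _ "Pow (s \<union> {x\<in>S0. \<iota> x \<le> n})"]) (use low[of n] in \<open>auto simp: F_def\<close>)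
  have F: "finite t \<and> s \<subseteq> t \<and> t \<subseteq> s \<union> S0" if "t \<in> F n" for t n
    using that finite_subset[OF _ low[of n], of t] by (auto simp: F_def)
  \<comment> \<open>The stem \<open>s\<close> has no last element outside \<open>s\<close> that
    could name a stage, so \<open>P s\<close> is secured beforehand.\<close>
  obtain S1 where S1: "S1 \<in> H" "S1 \<subseteq> S0" "P s S1" using dense[of s S0] S0 s by auto
  have S1': "above s S1 \<in> H" "above s S1 \<subseteq> S0" using above_mem[OF S1(1) s(1)] above_subset S1 by auto
  have "\<exists>U. \<forall>n. (U n \<in> H \<and> U n \<subseteq> above s S1 \<and> (\<forall>t\<in>F n. P t (U n))) \<and> U (Suc n) \<subseteq> U n"
  proof (rule dependent_nat_choice)
    show "\<exists>S. S \<in> H \<and> S \<subseteq> above s S1 \<and> (\<forall>t\<in>F 0. P t S)"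
      using finite_step[of "F 0" "above s S1"] finF F S1' by blast
    fix S n assume "S \<in> H \<and> S \<subseteq> above s S1 \<and> (\<forall>t\<in>F n. P t S)"
    then show "\<exists>S'. (S' \<in> H \<and> S' \<subseteq> above s S1 \<and> (\<forall>t\<in>F (Suc n). P t S')) \<and> S' \<subseteq> S"
      using finite_step[of "F (Suc n)" S] finF F S1' by (meson subset_trans)
  qed
  then obtain U where U: "\<And>n. U n \<in> H" "\<And>n. U n \<subseteq> above s S1" "\<And>n t. t \<in> F n \<Longrightarrow> P t (U n)"
      "\<And>n. U (Suc n) \<subseteq> U n" by blast
  then obtain D where D: "D \<in> H" "D \<subseteq> U 0" "\<And>x. x \<in> D \<Longrightarrow> above {x} D \<subseteq> U (\<iota> x)"
    using diag[of U] by (auto simp: decseq_SucI)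
  have D1: "D \<subseteq> above s S1" using D(2) U(2) by blast
  have "P t D" if t: "finite t" "s \<subseteq> t" "t \<subseteq> s \<union> D" for t
  proof (cases "t = s")
    case True
    then show ?thesis using hereditary[OF s(1) S1(3), of D] D D1 above_subset[of s S1] by auto
  next
    case False
    then have ne: "t - s \<noteq> {}" "finite (t - s)" using t by auto
    then have "Max (\<iota> ` (t - s)) \<in> \<iota> ` (t - s)" by (intro Max_in) auto
    then obtain x where "x \<in> t - s" "\<iota> x = Max (\<iota> ` (t - s))" by (metis imageE)
    then have x: "x \<in> t - s" "\<And>y. y \<in> t - s \<Longrightarrow> \<iota> y \<le> \<iota> x" using ne(2) by auto
    have xD: "x \<in> D" using x t by auto
    \<comment> \<open>The last new element \<open>x\<close> of \<open>t\<close> names the stage: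
      \<open>t\<close> was treated at \<open>\<iota> x\<close>, and beyond \<open>x\<close> the set
      \<open>D\<close> lies inside that stage.\<close>
    have "t \<in> F (\<iota> x)" using t x D1 S1(2) by (auto simp: F_def above_def)
    then have "P t (U (\<iota> x))" by (rule U(3))
    moreover have "above t D \<subseteq> U (\<iota> x)" using D(3)[OF xD] x(1) by (auto simp: above_def)
    ultimately have "P t (above t D)" using hereditary t(1) above_mem[OF D(1) t(1)] by blast
    then show ?thesis using tail t D by blast
  qed
  moreover have "D \<subseteq> above s S0" using D1 above_mono[OF S1(2)] by blast
  ultimately show ?thesis using D(1) by blast
qed

text \<open>Nash-Williams' combinatorial forcing: \<open>B\<close> accepts \<open>t\<close> if \<open>ext t B \<subseteq> U\<close>, and rejects \<open>t\<close> if no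
  subset of \<open>B\<close> in the coideal accepts \<open>t\<close>.\<close>

theorem copen_ramsey:
  assumes U: "copen U" and S: "S \<in> H" and s: "finite s" "s \<subseteq> A"
  shows "\<exists>B\<in>H. B \<subseteq> above s S \<and> (ext s B \<subseteq> U \<or> ext s B \<inter> U = {})"
proof -
  define rej where "rej B t \<longleftrightarrow> (\<forall>B'\<in>H. B' \<subseteq> B \<longrightarrow> \<not> ext t B' \<subseteq> U)" for B t
  have rej_anti: "rej B t \<Longrightarrow> B' \<subseteq> B \<Longrightarrow> rej B' t" for B B' t
    unfolding rej_def by blast
  \<comment> \<open>First fusion: either some subset of \<open>B\<close> in \<open>H\<close> accepts
    \<open>t\<close> or \<open>B\<close> itself rejects it, so every stem can be decided by
    shrinking, and stays decided.\<close>
  have "\<exists>D\<in>H. D \<subseteq> above s S \<and> (\<forall>t. finite t \<and> s \<subseteq> t \<and> t \<subseteq> s \<union> D \<longrightarrow> ext t D \<subseteq> U \<or> rej D t)"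
  proof (rule fusion[OF S s])
    fix t B
    assume "B \<in> H"
    then show "\<exists>S'\<in>H. S' \<subseteq> B \<and> (ext t S' \<subseteq> U \<or> rej S' t)" unfolding rej_def by blast
  next
    fix t B B'
    assume "ext t B \<subseteq> U \<or> rej B t" "B' \<subseteq> B"
    then show "ext t B' \<subseteq> U \<or> rej B' t" using ext_mono rej_anti by blast
  next
    fix t B
    assume t: "finite t" and a: "ext t (above t B) \<subseteq> U \<or> rej (above t B) t"
    have "rej B t" if "rej (above t B) t"
      unfolding rej_def
    proof (intro ballI impI notI)
      fix B' assume "B' \<in> H" "B' \<subseteq> B" "ext t B' \<subseteq> U"
      then have "above t B' \<in> H" "above t B' \<subseteq> above t B" "ext t (above t B') \<subseteq> U"
        using above_mem t above_mono by (auto simp: ext_above)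
      then show False using that unfolding rej_def by blast
    qed
    then show "ext t B \<subseteq> U \<or> rej B t" using a by (auto simp: ext_above)
  qed
  then obtain D where D: "D \<in> H" "D \<subseteq> above s S"
    and "\<forall>t. finite t \<and> s \<subseteq> t \<and> t \<subseteq> s \<union> D \<longrightarrow> ext t D \<subseteq> U \<or> rej D t"
    by (elim bexE conjE) (rule that)
  then have dec: "ext t D \<subseteq> U \<or> rej D t" if "finite t" "s \<subseteq> t" "t \<subseteq> s \<union> D" for t
    using that by blast
  show ?thesis
  proof (cases "ext s D \<subseteq> U")
    case True
    then show ?thesis using D by blast
  next
    case False
    then have rejs: "rej D s" using dec s by blast
    \<comment> \<open>Second fusion: rejection is measured against the fixed \<open>D\<close>; only
      the pool from which the next element \<open>y\<close> is drawn shrinks.\<close>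
    have "\<exists>E\<in>H. E \<subseteq> above s D \<and> (\<forall>t. finite t \<and> s \<subseteq> t \<and> t \<subseteq> s \<union> E \<longrightarrow>
        (rej D t \<longrightarrow> (\<forall>y\<in>above t E. rej D (insert y t))))"
    proof (rule fusion[OF D(1) s])
      fix t B
      assume t: "finite t" "s \<subseteq> t" "t \<subseteq> s \<union> D" and B: "B \<subseteq> D" "B \<in> H"
      define B1 where "B1 = {y\<in>above t B. ext (insert y t) D \<subseteq> U}"
      define B2 where "B2 = {y\<in>above t B. rej D (insert y t)}"
      have "above t B \<subseteq> B1 \<union> B2"
      proof
        fix y assume y: "y \<in> above t B"
        then have "insert y t \<subseteq> s \<union> D" using t B above_subset by blast
        then have "ext (insert y t) D \<subseteq> U \<or> rej D (insert y t)" using dec[of "insert y t"] t by auto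
        then show "y \<in> B1 \<union> B2" using y by (auto simp: B1_def B2_def)
      qed
      then have "B1 \<union> B2 = above t B" by (auto simp: B1_def B2_def)
      then have "B1 \<union> B2 \<in> H" using above_mem[OF B(2) t(1)] by simp
      \<comment> \<open>The coideal property makes one kind of one-point extension large. If the
        accepted ones are, \<open>B1\<close> accepts \<open>t\<close> itself, so \<open>t\<close>
        was not rejected.\<close>
      then consider "B1 \<in> H" | "B2 \<in> H" using split by blast
      then show "\<exists>S'\<in>H. S' \<subseteq> B \<and> (rej D t \<longrightarrow> (\<forall>y\<in>above t S'. rej D (insert y t)))"
      proof cases
        case 1
        have "ext t B1 \<subseteq> U"
        proof
          fix Y assume Y: "Y \<in> ext t B1"
          then have "infinite (Y - t)" using infinite t by (auto simp: ext_def)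
          then have ne: "Y - t \<noteq> {}" using finite.emptyI by metis
          then obtain y where y: "y \<in> Y - t" "\<And>z. z \<in> Y - t \<Longrightarrow> \<iota> y \<le> \<iota> z"
            using ex_has_least_nat[of "\<lambda>z. z \<in> Y - t" _ \<iota>] by blast
          have YA: "Y \<subseteq> A" using Y carrier by (auto simp: ext_def)
          have less: "\<iota> y < \<iota> z" if "z \<in> Y - insert y t" for z
          proof -
            have "\<iota> y \<noteq> \<iota> z" using that y(1) YA inj by (auto dest: inj_onD)
            then show ?thesis using y(2)[of z] that by simp
          qed
          have "B1 \<subseteq> D" using B above_subset[of t B] by (auto simp: B1_def)
          then have "Y - t \<subseteq> D" using extD(3)[OF Y] by blast
          \<comment> \<open>As \<open>y\<close> is the first element of \<open>Y\<close> after
            \<open>t\<close>, the set \<open>insert y t\<close> is again an initial segment of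
            \<open>Y\<close>.\<close>
          then have "Y \<in> ext (insert y t) D"
            using extD(1,2,4)[OF Y] y(1) less by (intro extI) blast+
          moreover have "y \<in> B1" using extD(3)[OF Y] y(1) by blast
          ultimately show "Y \<in> U" by (auto simp: B1_def)
        qed
        moreover have "B1 \<subseteq> D" using B above_subset by (auto simp: B1_def above_def)
        ultimately have "\<not> rej D t" using 1 unfolding rej_def by blast
        then show ?thesis using B by blast
      next
        case 2
        then show ?thesis by (intro bexI[of _ B2]) (auto simp: B2_def above_def)
      qed
    next
      fix t B B'
      assume "rej D t \<longrightarrow> (\<forall>y\<in>above t B. rej D (insert y t))" "B' \<subseteq> B"
      then show "rej D t \<longrightarrow> (\<forall>y\<in>above t B'. rej D (insert y t))" using above_mono by blast
    next
      fix t B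
      assume "rej D t \<longrightarrow> (\<forall>y\<in>above t (above t B). rej D (insert y t))"
      then show "rej D t \<longrightarrow> (\<forall>y\<in>above t B. rej D (insert y t))" by (simp add: above_above)
    qed
    then obtain E where E: "E \<in> H" "E \<subseteq> above s D"
      and "\<forall>t. finite t \<and> s \<subseteq> t \<and> t \<subseteq> s \<union> E \<longrightarrow> rej D t \<longrightarrow> (\<forall>y\<in>above t E. rej D (insert y t))"
      by (elim bexE conjE) (rule that)
    then have step: "rej D (insert y t)"
      if "finite t" "s \<subseteq> t" "t \<subseteq> s \<union> E" "rej D t" "y \<in> above t E" for t y
      using that by blast
    \<comment> \<open>Elements enter in order of increasing index, so each lies above the stem built
      so far and \<open>step\<close> applies.\<close>
    have rejE: "r \<subseteq> E \<longrightarrow> rej D (s \<union> r)" if "finite r" for r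
      using that
    proof (induction r rule: finite_ranking_induct[where f = \<iota>])
      case empty
      then show ?case using rejs by simp
    next
      case (insert y r)
      show ?case
      proof (cases "y \<in> r")
        case False
        show ?thesis
        proof
          assume r: "insert y r \<subseteq> E"
          have EA: "E \<subseteq> A" using E carrier by blast
          have "\<iota> x < \<iota> y" if "x \<in> r" for x
          proof -
            have "x \<in> A" "y \<in> A" "x \<noteq> y" using that r EA False by auto
            then have "\<iota> x \<noteq> \<iota> y" using inj by (auto dest: inj_onD)
            then show ?thesis using insert.hyps(2)[OF that] by simp
          qed
          then have "y \<in> above (s \<union> r) E" using r E(2) by (auto simp: above_def)
          then show "rej D (s \<union> insert y r)" using step[of "s \<union> r" y] insert r s by auto
        qed
      qed (use insert in \<open>simp add: insert_absorb\<close>)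
    qed
    have "False" if Y: "Y \<in> ext s E" "Y \<in> U" for Y
    proof -
      obtain t where t: "finite t" "Y \<in> ext t Y" "ext t Y \<subseteq> U"
        using U Y(2) unfolding copen_def by blast
      have YH: "Y \<in> H" using extD(1)[OF Y(1)] .
      have "s \<union> (t - s) = s \<union> t" by blast
      moreover have "t - s \<subseteq> E" using extD(2)[OF t(2)] extD(3)[OF Y(1)] by blast
      moreover have "finite (t - s)" using t(1) by simp
      ultimately have "rej D (s \<union> t)" using rejE[of "t - s"] by simp
      moreover have "Y - (s \<union> t) \<in> H" using Diff_finite[OF YH] s t by simp
      moreover have "Y - (s \<union> t) \<subseteq> D" using extD(3)[OF Y(1)] E(2) above_subset[of s D] by blast
      \<comment> \<open>The rest of \<open>Y\<close> accepts a stem that was shown to be rejected.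
        The stem is \<open>s \<union> t\<close> because rejection is known only for stems extending
        \<open>s\<close>, while \<open>t\<close> may be shorter than \<open>s\<close>.\<close>
      moreover have "ext (s \<union> t) (Y - (s \<union> t)) \<subseteq> U"
        using ext_join(2)[OF mem_ext_self[OF Y(1)] t(2)] t(3) ext_mono[of "Y - (s \<union> t)" Y] by blast
      ultimately show False unfolding rej_def by blast
    qed
    moreover have "E \<subseteq> above s S" using E D above_subset by blast
    ultimately show ?thesis using E(1) by blast
  qed
qed

text \<open>Colours are eliminated one at a time by the open case. Initial segments of one set are
  comparable, so by thinness at most one member of \<open>T\<close> heads a given set; in the
  positive alternative every member of \<open>T\<close> inside \<open>E\<close> therefore has the
  current colour.\<close>

theorem nash_williams:
  fixes n :: nat
  assumes T: "\<And>t. t \<in> T \<Longrightarrow> finite t \<and> t \<subseteq> A"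
    and thinT: "\<And>t u. t \<in> T \<Longrightarrow> u \<in> T \<Longrightarrow> t \<subseteq> u \<Longrightarrow> \<forall>x\<in>t. \<forall>y\<in>u - t. \<iota> x < \<iota> y \<Longrightarrow> t = u"
    and S: "S \<in> H" and n: "n \<ge> 1" "\<And>t. t \<in> T \<Longrightarrow> c t \<in> {1..n}"
  shows "\<exists>B\<in>H. B \<subseteq> S \<and> (\<exists>i\<in>{1..n}. \<forall>t\<in>T. t \<subseteq> B \<longrightarrow> c t = i)"
proof -
  have "\<exists>B\<in>H. B \<subseteq> S \<and> ((\<exists>i\<in>{1..n}. \<forall>t\<in>T. t \<subseteq> B \<longrightarrow> c t = i) \<or> (\<forall>t\<in>T. t \<subseteq> B \<longrightarrow> c t > m))"
    if "m \<le> n" for m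
    using that
  proof (induction m)
    case 0
    then show ?case using S n by (intro bexI[of _ S]) force+
  next
    case (Suc m)
    then obtain B where B: "B \<in> H" "B \<subseteq> S"
      "(\<exists>i\<in>{1..n}. \<forall>t\<in>T. t \<subseteq> B \<longrightarrow> c t = i) \<or> (\<forall>t\<in>T. t \<subseteq> B \<longrightarrow> c t > m)" by auto
    define U where "U = {Y\<in>H. \<exists>t\<in>T. c t = Suc m \<and> Y \<in> ext t Y}"
    have "copen U" unfolding copen_def
    proof (intro conjI ballI)
      fix Y assume "Y \<in> U"
      then obtain t where t: "t \<in> T" "c t = Suc m" "Y \<in> ext t Y" by (auto simp: U_def)
      have "ext t Y \<subseteq> U"
      proof
        fix Z assume Z: "Z \<in> ext t Y"
        then have "Z \<in> ext t Z" by (rule mem_ext_self)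
        then show "Z \<in> U" using t unfolding U_def by (auto simp: ext_def)
      qed
      then show "\<exists>t. finite t \<and> Y \<in> ext t Y \<and> ext t Y \<subseteq> U" using t T by blast
    qed (auto simp: U_def)
    then obtain E where E: "E \<in> H" "E \<subseteq> B" "ext {} E \<subseteq> U \<or> ext {} E \<inter> U = {}"
      using copen_ramsey[of U B "{}"] B(1) above_subset by blast
    have witness: "\<exists>Y. Y \<in> ext {} E \<and> Y \<in> ext t Y" if "t \<in> T" "t \<subseteq> E" for t
    proof -
      have "t \<union> above t E \<in> ext t E" using Un_above_mem_ext E T that by blast
      then show ?thesis using mem_ext_self that above_subset by (auto simp: ext_def above_def)
    qed
    have "(\<forall>t\<in>T. t \<subseteq> E \<longrightarrow> c t = Suc m) \<or> (\<forall>t\<in>T. t \<subseteq> E \<longrightarrow> c t \<noteq> Suc m)"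
      using E(3)
    proof
      assume E3: "ext {} E \<subseteq> U"
      have "c t = Suc m" if t: "t \<in> T" "t \<subseteq> E" for t
      proof -
        obtain Y where Y: "Y \<in> ext {} E" "Y \<in> ext t Y" using witness t by blast
        then obtain u where u: "u \<in> T" "c u = Suc m" "Y \<in> ext u Y" using E3 by (auto simp: U_def)
        have *: "p - r = {} \<or> r - p = {}" if "Y \<in> ext p Y" "Y \<in> ext r Y" for p r
          using that by (fastforce simp: ext_def above_def)
        have "t = u"
        proof (cases "t \<subseteq> u")
          case True
          then have "u - t \<subseteq> Y - t" using extD(2)[OF u(3)] by blast
          then show ?thesis using thinT[of t u] True t u extD(4)[OF Y(2)] by blast
        next
          case False
          then have "u \<subseteq> t" using *[OF Y(2) u(3)] by blast
          then have "t - u \<subseteq> Y - u" using extD(2)[OF Y(2)] by blast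
          then show ?thesis using thinT[of u t] \<open>u \<subseteq> t\<close> t u extD(4)[OF u(3)] by blast
        qed
        then show ?thesis using u by simp
      qed
      then show ?thesis by blast
    next
      assume E3: "ext {} E \<inter> U = {}"
      have "c t \<noteq> Suc m" if t: "t \<in> T" "t \<subseteq> E" for t
      proof
        assume "c t = Suc m"
        moreover obtain Y where "Y \<in> ext {} E" "Y \<in> ext t Y" using witness t by blast
        ultimately have "Y \<in> U" using t by (auto simp: U_def ext_def)
        then show False using E3 \<open>Y \<in> ext {} E\<close> by blast
      qed
      then show ?thesis by blast
    qed
    then have "(\<exists>i\<in>{1..n}. \<forall>t\<in>T. t \<subseteq> E \<longrightarrow> c t = i) \<or> (\<forall>t\<in>T. t \<subseteq> E \<longrightarrow> c t > Suc m)"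
    proof
      assume "\<forall>t\<in>T. t \<subseteq> E \<longrightarrow> c t = Suc m"
      moreover have "Suc m \<in> {1..n}" using Suc.prems by simp
      ultimately show ?thesis by blast
    next
      assume ne: "\<forall>t\<in>T. t \<subseteq> E \<longrightarrow> c t \<noteq> Suc m"
      from B(3) show ?thesis
      proof
        assume "\<exists>i\<in>{1..n}. \<forall>t\<in>T. t \<subseteq> B \<longrightarrow> c t = i"
        then show ?thesis using E(2) by (meson subset_trans)
      next
        assume "\<forall>t\<in>T. t \<subseteq> B \<longrightarrow> m < c t"
        then have "\<forall>t\<in>T. t \<subseteq> E \<longrightarrow> Suc m < c t" using ne E(2) by (metis Suc_lessI subset_trans)
        then show ?thesis by blast
      qed
    qed
    moreover have "E \<subseteq> S" using E(2) B(2) by blast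
    ultimately show ?case using E(1) by blast
  qed
  from this[of n] obtain B where B: "B \<in> H" "B \<subseteq> S"
    "(\<exists>i\<in>{1..n}. \<forall>t\<in>T. t \<subseteq> B \<longrightarrow> c t = i) \<or> (\<forall>t\<in>T. t \<subseteq> B \<longrightarrow> c t > n)" by blast
  \<comment> \<open>For \<open>m = n\<close> the second alternative means that no member of
    \<open>T\<close> lies inside \<open>B\<close>; any colour will do, and \<open>n \<ge> 1\<close>
    supplies one.\<close>
  then show ?thesis using n by (meson atLeastAtMost_iff leD order_refl)
qed

section \<open>Meager sets and the Baire property in the relative Ellentuck topology\<close>

context
  fixes \<tau> :: "'b set topology"
  assumes open_iff: "\<And>U. openin \<tau> U \<longleftrightarrow> copen U"
begin

lemma topspace_eq: "topspace \<tau> = H"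
proof -
  have "copen H" unfolding copen_def
    by (intro conjI ballI exI[of _ "{}"]) (auto simp: ext_def above_def)
  moreover have "copen (topspace \<tau>)" using open_iff by blast
  ultimately show ?thesis using open_iff openin_subset[of \<tau> H]
    by (auto simp: copen_def[of "topspace \<tau>"])
qed

text \<open>The complement of the closure is open, so \<open>copen_ramsey\<close> applies. The bad
  alternative would place the nonempty open set \<open>ext s B\<close> inside the closure of
  \<open>N\<close>.\<close>

lemma nowhere_dense_ramsey:
  assumes N: "nowhere_dense_in \<tau> N" and S: "S \<in> H" and s: "finite s" "s \<subseteq> A"
  shows "\<exists>B\<in>H. B \<subseteq> above s S \<and> ext s B \<inter> N = {}"
proof -
  have "copen (H - \<tau> closure_of N)"
    using closedin_closure_of[of \<tau> N] topspace_eq by (simp add: closedin_def open_iff)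
  then obtain B where B: "B \<in> H" "B \<subseteq> above s S"
    "ext s B \<subseteq> H - \<tau> closure_of N \<or> ext s B \<inter> (H - \<tau> closure_of N) = {}"
    using copen_ramsey[OF _ S s] by meson
  have "\<not> ext s B \<subseteq> \<tau> closure_of N"
  proof
    assume "ext s B \<subseteq> \<tau> closure_of N"
    then have "ext s B \<subseteq> \<tau> interior_of (\<tau> closure_of N)"
      using copen_ext[OF s(1)] open_iff by (simp add: interior_of_maximal)
    then show False using Un_above_mem_ext[OF B(1) s] N by (auto simp: nowhere_dense_in_def)
  qed
  moreover have "ext s B \<subseteq> H" by (auto simp: ext_def)
  ultimately have "ext s B \<subseteq> H - \<tau> closure_of N" using B(3) by blast
  moreover have "N \<subseteq> \<tau> closure_of N" using N closure_of_subset by (auto simp: nowhere_dense_in_def)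
  ultimately show ?thesis using B by blast
qed

text \<open>A stem \<open>t\<close> has to deal only with the first \<open>card t\<close> nowhere
  dense sets, a finite task that fusion can handle for all stems together. Every \<open>Y\<close>
  has initial segments of arbitrarily large size, so each \<open>N i\<close> is eventually
  avoided.\<close>

lemma meager_ramsey:
  assumes M: "meager_in \<tau> M" and S: "S \<in> H" and s: "finite s" "s \<subseteq> A"
  shows "\<exists>B\<in>H. B \<subseteq> above s S \<and> ext s B \<inter> M = {}"
proof -
  obtain F where F: "countable F" "\<And>N. N \<in> F \<Longrightarrow> nowhere_dense_in \<tau> N" "M = \<Union>F"
    using M by (auto simp: meager_in_def)
  show ?thesis
  proof (cases "F = {}")
    case True
    then show ?thesis using F(3) above_mem[OF S s(1)] by blast
  next
    case False
    define N where "N = from_nat_into F"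
    have N: "nowhere_dense_in \<tau> (N i)" for i using F(2) False by (simp add: N_def from_nat_into)
    have MN: "M = (\<Union>i. N i)" using F False by (simp add: N_def)
    have "\<exists>D\<in>H. D \<subseteq> above s S \<and> (\<forall>t. finite t \<and> s \<subseteq> t \<and> t \<subseteq> s \<union> D \<longrightarrow> (\<forall>i<card t. ext t D \<inter> N i = {}))"
    proof (rule fusion[OF S s])
      fix t B assume t: "finite t" "t \<subseteq> s \<union> S" and B: "B \<in> H"
      have tA: "t \<subseteq> A" using t s carrier[OF S] by blast
      have "\<exists>S'\<in>H. S' \<subseteq> B \<and> (\<forall>i<m. ext t S' \<inter> N i = {})" for m
      proof (induction m)
        case 0
        then show ?case using B by auto
      next
        case (Suc m)
        then obtain S1 where S1: "S1 \<in> H" "S1 \<subseteq> B" "\<forall>i<m. ext t S1 \<inter> N i = {}" by blast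
        obtain S2 where S2: "S2 \<in> H" "S2 \<subseteq> above t S1" "ext t S2 \<inter> N m = {}"
          using nowhere_dense_ramsey[OF N S1(1) t(1) tA] by blast
        have "S2 \<subseteq> S1" using S2 above_subset by blast
        then show ?case using S1 S2 ext_mono[of S2 S1 t]
          by (intro bexI[of _ S2]) (fastforce simp: less_Suc_eq)+
      qed
      then show "\<exists>S'\<in>H. S' \<subseteq> B \<and> (\<forall>i<card t. ext t S' \<inter> N i = {})" .
    next
      fix t B B'
      assume "\<forall>i<card t. ext t B \<inter> N i = {}" "B' \<subseteq> B"
      then show "\<forall>i<card t. ext t B' \<inter> N i = {}" using ext_mono[of B' B t] by blast
    next
      fix t B
      assume "\<forall>i<card t. ext t (above t B) \<inter> N i = {}"
      then show "\<forall>i<card t. ext t B \<inter> N i = {}" by (simp add: ext_above)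
    qed
    then obtain D where D: "D \<in> H" "D \<subseteq> above s S"
      "\<forall>t. finite t \<and> s \<subseteq> t \<and> t \<subseteq> s \<union> D \<longrightarrow> (\<forall>i<card t. ext t D \<inter> N i = {})"
      by (elim bexE conjE) (rule that)
    have "Y \<notin> N i" if Y: "Y \<in> ext s D" for Y i
    proof -
      have YH: "Y \<in> H" and YA: "Y \<subseteq> A" and sY: "s \<subseteq> Y" using Y carrier by (auto simp: ext_def)
      obtain r where r: "r \<subseteq> Y" "finite r" "card r = Suc i"
        using infinite[OF YH] infinite_arbitrarily_large by blast
      \<comment> \<open>An initial segment of \<open>Y\<close> that extends \<open>s\<close> and
        contains \<open>r\<close>, hence has more than \<open>i\<close> elements.\<close>
      define t where "t = s \<union> {x\<in>Y. \<exists>y\<in>r. \<iota> x \<le> \<iota> y}"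
      have "finite {x\<in>Y. \<exists>y\<in>r. \<iota> x \<le> \<iota> y}"
        by (rule finite_subset[OF _ finite_not_above[OF r(2)]]) (use YA in auto)
      then have fin: "finite t" using s by (simp add: t_def)
      moreover have "r \<subseteq> t" using r by (auto simp: t_def)
      ultimately have "i < card t" using r card_mono[of t r] by simp
      moreover have "t \<subseteq> s \<union> D" using Y sY by (auto simp: t_def ext_def above_def)
      moreover have "\<iota> x < \<iota> y" if xy: "x \<in> t" "y \<in> Y - t" for x y
      proof (cases "x \<in> s")
        case True
        then show ?thesis using extD(4)[OF Y, of x y] xy by (auto simp: t_def)
      next
        case False
        then obtain z where z: "z \<in> r" "\<iota> x \<le> \<iota> z" using xy by (auto simp: t_def)
        moreover have "\<not> \<iota> y \<le> \<iota> z" using xy z(1) by (auto simp: t_def)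
        ultimately show ?thesis by simp
      qed
      then have "Y \<in> ext t D"
        using YH sY extD(3)[OF Y] by (intro extI) (auto simp: t_def)
      moreover have "s \<subseteq> t" by (simp add: t_def)
      ultimately show ?thesis using D(3) fin by blast
    qed
    then show ?thesis using D MN by blast
  qed
qed

text \<open>Once \<open>ext s B\<close> avoids \<open>M\<close>, the sets \<open>R\<close> and
  \<open>U\<close> agree on it, and the open case decides.\<close>

theorem ellentuck_ramsey:
  assumes R: "baire_property_in \<tau> R" and S: "S \<in> H" and s: "finite s" "s \<subseteq> A"
  shows "\<exists>B\<in>H. B \<subseteq> above s S \<and> (ext s B \<subseteq> R \<or> ext s B \<inter> R = {})"
proof -
  obtain U M where UM: "copen U" "meager_in \<tau> M" "R = (U - M) \<union> (M - U)"
    using R open_iff by (auto simp: baire_property_in_def)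
  obtain B where B: "B \<in> H" "B \<subseteq> above s S" "ext s B \<inter> M = {}"
    using meager_ramsey[OF UM(2) S s] by blast
  obtain E where E: "E \<in> H" "E \<subseteq> above s B" "ext s E \<subseteq> U \<or> ext s E \<inter> U = {}"
    using copen_ramsey[OF UM(1) B(1) s] by blast
  have "E \<subseteq> B" using E above_subset by blast
  then have "ext s E \<inter> M = {}" using B ext_mono[of E B s] by blast
  then have "ext s E \<subseteq> R \<or> ext s E \<inter> R = {}" using E(3) UM(3) by blast
  then show ?thesis using E(1) \<open>E \<subseteq> B\<close> B(2) by blast
qed

end

end

section \<open>Omega-covers\<close>

lemma omega_coverI:
  assumes "\<And>V. V \<in> U \<Longrightarrow> openin X V" "topspace X \<notin> U"
    and cov: "\<And>F. finite F \<Longrightarrow> F \<subseteq> topspace X \<Longrightarrow> \<exists>V\<in>U. F \<subseteq> V"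
  shows "U \<in> omega_covers X"
proof -
  have "\<Union>U = topspace X"
  proof
    show "\<Union>U \<subseteq> topspace X" using assms(1) openin_subset by blast
    show "topspace X \<subseteq> \<Union>U" using cov[of "{x}" for x] by auto
  qed
  then show ?thesis using assms by (auto simp: omega_covers_def)
qed

lemma omega_coverD:
  assumes "U \<in> omega_covers X"
  shows "\<And>V. V \<in> U \<Longrightarrow> openin X V" "topspace X \<notin> U"
    "\<And>F. finite F \<Longrightarrow> F \<subseteq> topspace X \<Longrightarrow> \<exists>V\<in>U. F \<subseteq> V"
  using assms by (auto simp: omega_covers_def)

lemma omega_cover_subset:
  assumes A: "A \<in> omega_covers X" and "B \<subseteq> A"
    and cov: "\<And>F. finite F \<Longrightarrow> F \<subseteq> topspace X \<Longrightarrow> \<exists>V\<in>B. F \<subseteq> V"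
  shows "B \<in> omega_covers X"
proof (rule omega_coverI[OF _ _ cov])
  show "openin X V" if "V \<in> B" for V using omega_coverD(1)[OF A] assms(2) that by blast
  show "topspace X \<notin> B" using omega_coverD(2)[OF A] assms(2) by blast
qed

lemma omega_cover_proper:
  assumes "U \<in> omega_covers X" "V \<in> U"
  shows "\<exists>x\<in>topspace X. x \<notin> V"
  using assms omega_coverD(1,2)[OF assms(1)] openin_subset by (metis subsetI subset_antisym)

text \<open>Enlarge \<open>F\<close> by one point outside each \<open>V \<in> K\<close> and cover
  the enlarged set.\<close>

lemma omega_cover_avoid:
  assumes U: "U \<in> omega_covers X" and K: "finite K" "\<And>V. V \<in> K \<Longrightarrow> \<exists>x\<in>topspace X. x \<notin> V"
    and F: "finite F" "F \<subseteq> topspace X"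
  shows "\<exists>W\<in>U. F \<subseteq> W \<and> (\<forall>V\<in>K. \<not> W \<subseteq> V)"
proof -
  obtain x where x: "\<And>V. V \<in> K \<Longrightarrow> x V \<in> topspace X \<and> x V \<notin> V" using K(2) by metis
  have "F \<union> x ` K \<subseteq> topspace X" using x F by auto
  then obtain W where "W \<in> U" "F \<union> x ` K \<subseteq> W"
    using omega_coverD(3)[OF U, of "F \<union> x ` K"] K F by auto
  then show ?thesis using x by blast
qed

text \<open>If there were only finitely many, \<open>omega_cover_avoid\<close> would give a further
  superset of \<open>F\<close> contained in none of them, not even in itself.\<close>

lemma omega_cover_infinite_superset:
  assumes U: "U \<in> omega_covers X" and F: "finite F" "F \<subseteq> topspace X"
  shows "infinite {V\<in>U. F \<subseteq> V}"
proof
  assume "finite {V\<in>U. F \<subseteq> V}"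
  then show False
    using omega_cover_avoid[OF U _ _ F, of "{V\<in>U. F \<subseteq> V}"] omega_cover_proper[OF U] by blast
qed

lemma omega_cover_infinite: "U \<in> omega_covers X \<Longrightarrow> infinite U"
  using omega_cover_infinite_superset[of U X "{}"] by simp

text \<open>If \<open>F\<close> defeats \<open>B\<close> and \<open>G\<close> defeats
  \<open>C\<close>, then \<open>F \<union> G\<close> defeats the union.\<close>

lemma omega_cover_split:
  assumes "B \<union> C \<in> omega_covers X"
  shows "B \<in> omega_covers X \<or> C \<in> omega_covers X"
proof (rule ccontr)
  assume *: "\<not> ?thesis"
  obtain F where F: "finite F" "F \<subseteq> topspace X" "\<forall>V\<in>B. \<not> F \<subseteq> V"
    using omega_cover_subset[OF assms, of B] * by blast
  obtain G where G: "finite G" "G \<subseteq> topspace X" "\<forall>V\<in>C. \<not> G \<subseteq> V"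
    using omega_cover_subset[OF assms, of C] * by blast
  show False using omega_coverD(3)[OF assms, of "F \<union> G"] F G by auto
qed

lemma omega_cover_mono:
  assumes "A \<in> omega_covers X" "B \<in> omega_covers X" "B \<subseteq> C" "C \<subseteq> A"
  shows "C \<in> omega_covers X"
proof (rule omega_cover_subset[OF assms(1,4)])
  fix F assume "finite F" "F \<subseteq> topspace X"
  then show "\<exists>V\<in>C. F \<subseteq> V" using omega_coverD(3)[OF assms(2)] assms(3) by blast
qed

text \<open>Among \<open>n + 1\<close> members from distinct blocks (fibres of \<open>h\<close>) there is always one whose block differs
  from the \<open>n\<close> blocks chosen before.\<close>
lemma S1_transversal:
  assumes S1: "S1 (omega_covers X) (omega_covers X)" and D: "D \<in> omega_covers X"
    and fib: "\<And>k::nat. finite {V\<in>D. h V = k}"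
  shows "\<exists>C. C \<subseteq> D \<and> C \<in> omega_covers X \<and> inj_on h C"
proof -
  define W where "W n = {\<Inter>E |E. E \<subseteq> D \<and> finite E \<and> card E = Suc n \<and> inj_on h E}" for n
  have "W n \<in> omega_covers X" for n
  proof (rule omega_coverI)
    fix V assume "V \<in> W n"
    then obtain E where E: "V = \<Inter>E" "E \<subseteq> D" "finite E" "card E = Suc n" by (auto simp: W_def)
    then show "openin X V" using omega_coverD(1)[OF D] by (auto intro!: openin_Inter)
  next
    show "topspace X \<notin> W n"
    proof
      assume "topspace X \<in> W n"
      then obtain E where E: "topspace X = \<Inter>E" "E \<subseteq> D" "card E = Suc n" by (auto simp: W_def)
      then obtain V where "V \<in> E" by fastforce
      then show False using omega_cover_proper[OF D, of V] E by auto
    qed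
  next
    fix F assume F: "finite F" "F \<subseteq> topspace X"
    let ?D = "{V\<in>D. F \<subseteq> V}"
    \<comment> \<open>Blocks are finite, so the infinitely many supersets of \<open>F\<close> occupy
      infinitely many blocks, from which \<open>n + 1\<close> can be drawn.\<close>
    have "infinite (h ` ?D)"
    proof
      assume "finite (h ` ?D)"
      then have "finite (\<Union>k\<in>h ` ?D. {V\<in>D. h V = k})" using fib by blast
      moreover have "?D \<subseteq> (\<Union>k\<in>h ` ?D. {V\<in>D. h V = k})" by blast
      ultimately have "finite ?D" by (rule finite_subset[rotated])
      then show False using omega_cover_infinite_superset[OF D F] by contradiction
    qed
    then obtain K where K: "finite K" "card K = Suc n" "K \<subseteq> h ` ?D"
      using infinite_arbitrarily_large[of "h ` ?D" "Suc n"] by blast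
    obtain E where E: "E \<subseteq> ?D" "inj_on h E" "K = h ` E" using iffD1[OF subset_image_inj K(3)] by blast
    then have "card E = Suc n" "finite E" using K by (auto simp: card_image finite_image_iff)
    then have "\<Inter>E \<in> W n" using E by (auto simp: W_def)
    then show "\<exists>V\<in>W n. F \<subseteq> V" using E by blast
  qed
  then obtain T where T: "\<And>n. T n \<in> W n" "range T \<in> omega_covers X"
    using S1 unfolding S1_def by meson
  then have "\<forall>n. \<exists>E. T n = \<Inter>E \<and> E \<subseteq> D \<and> finite E \<and> card E = Suc n \<and> inj_on h E"
    by (auto simp: W_def)
  then obtain E where E: "\<And>n. T n = \<Inter>(E n)" "\<And>n. E n \<subseteq> D" "\<And>n. finite (E n)"
    "\<And>n. card (E n) = Suc n" "\<And>n. inj_on h (E n)" by metis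
  have "\<exists>c. \<forall>n. c n \<in> E n \<and> h (c n) \<notin> (\<lambda>m. h (c m)) ` {..<n}"
  proof (rule dependent_wellorder_choice)
    fix n and c :: "nat \<Rightarrow> 'a set"
    have "card ((\<lambda>m. h (c m)) ` {..<n}) < card (h ` E n)"
      using card_image_le[of "{..<n}" "\<lambda>m. h (c m)"] E(4,5)[of n] by (simp add: card_image)
    then have "\<not> h ` E n \<subseteq> (\<lambda>m. h (c m)) ` {..<n}"
      by (meson card_mono finite_imageI finite_lessThan leD)
    then show "\<exists>r. r \<in> E n \<and> h r \<notin> (\<lambda>m. h (c m)) ` {..<n}" by blast
  next
    fix r n and f g :: "nat \<Rightarrow> 'a set"
    assume "\<And>m. m < n \<Longrightarrow> f m = g m"
    then have "(\<lambda>m. h (f m)) ` {..<n} = (\<lambda>m. h (g m)) ` {..<n}" by auto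
    then show "(r \<in> E n \<and> h r \<notin> (\<lambda>m. h (f m)) ` {..<n}) = (r \<in> E n \<and> h r \<notin> (\<lambda>m. h (g m)) ` {..<n})"
      by simp
  qed
  then obtain c where c: "\<And>n. c n \<in> E n" "\<And>n. h (c n) \<notin> (\<lambda>m. h (c m)) ` {..<n}" by metis
  have "h (c n) \<noteq> h (c m)" if "m < n" for m n using c(2)[of n] that by blast
  then have neq: "h (c n) \<noteq> h (c m)" if "m \<noteq> n" for m n using that by (metis nat_neq_iff)
  have "inj_on h (range c)"
    using neq by (intro inj_onI) (metis rangeE)
  moreover have sub: "range c \<subseteq> D" using c E by blast
  \<comment> \<open>Passing from \<open>T n\<close> to the member \<open>c n\<close> of
    \<open>E n\<close> only enlarges the set, so finite sets stay covered.\<close>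
  moreover have "range c \<in> omega_covers X"
  proof (rule omega_cover_subset[OF D sub])
    fix F assume "finite F" "F \<subseteq> topspace X"
    then obtain n where "F \<subseteq> T n" using omega_coverD(3)[OF T(2), of F] by auto
    then show "\<exists>V\<in>range c. F \<subseteq> V" using E(1)[of n] c(1)[of n] by blast
  qed
  ultimately show ?thesis by blast
qed

section \<open>The coideal of omega-covers inside a countable omega-cover\<close>

locale ctbl_omega_cover =
  fixes X :: "'a topology" and enum :: "'a set set \<Rightarrow> nat \<Rightarrow> 'a set" and A :: "'a set set"
  assumes cover: "A \<in> omega_covers X" "countable A" and bij: "bij_betw (enum A) UNIV A"
begin

abbreviation H where "H \<equiv> ctbl_inf_subsets A \<inter> omega_covers X"

lemma mem_H: "B \<subseteq> A \<Longrightarrow> B \<in> H \<longleftrightarrow> B \<in> omega_covers X"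
  using cover omega_cover_infinite countable_subset by (auto simp: ctbl_inf_subsets_def)

lemma A_H: "A \<in> H" using mem_H cover by blast

sublocale coideal "idx enum A" A H
proof
  show "inj_on (idx enum A) A"
    using bij inj_on_inv_into[of A "enum A" UNIV] unfolding idx_def bij_betw_def by simp
  show "B \<in> H \<Longrightarrow> B \<subseteq> A" "B \<in> H \<Longrightarrow> infinite B" for B by (auto simp: ctbl_inf_subsets_def)
  show "B \<in> H \<Longrightarrow> B \<subseteq> C \<Longrightarrow> C \<subseteq> A \<Longrightarrow> C \<in> H" for B C
    using omega_cover_mono cover(1) mem_H by blast
  fix B C assume "B \<union> C \<in> H"
  then have "B \<union> C \<subseteq> A" "B \<union> C \<in> omega_covers X" by (auto simp: ctbl_inf_subsets_def)
  then show "B \<in> H \<or> C \<in> H" using omega_cover_split mem_H by blast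
qed

lemma above_eq_restr: "above s B = restr enum A B s"
  by (auto simp: above_def restr_def seg_less_def)

lemma ext_eq_ell_int: "ext s B = ell_int enum A s B \<inter> omega_covers X"
proof
  show "ell_int enum A s B \<inter> omega_covers X \<subseteq> ext s B"
    by (auto simp: ext_def above_def ell_int_def seg_less_def)
  show "ext s B \<subseteq> ell_int enum A s B \<inter> omega_covers X"
  proof
    fix Y assume Y: "Y \<in> ext s B"
    have eq: "s \<union> (Y - s) = Y" using extD(2)[OF Y] by blast
    have "seg_less enum A s (Y - s)" using extD(4)[OF Y] by (simp add: seg_less_def)
    moreover have "s \<union> (Y - s) \<in> ctbl_inf_subsets A" using extD(1)[OF Y] unfolding eq by blast
    ultimately have "s \<union> (Y - s) \<in> ell_int enum A s B"
      using extD(3)[OF Y] unfolding ell_int_def by blast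
    then show "Y \<in> ell_int enum A s B \<inter> omega_covers X" using extD(1)[OF Y] unfolding eq by blast
  qed
qed

lemma ell_int_Int_H: "ell_int enum A s B \<inter> H = ext s B"
  unfolding ext_eq_ell_int by (auto simp: ell_int_def)

lemma ext_empty: "B \<subseteq> A \<Longrightarrow> ext {} B = ctbl_inf_subsets B \<inter> omega_covers X"
proof -
  assume B: "B \<subseteq> A"
  have "Y \<in> ext {} B \<longleftrightarrow> Y \<in> H \<and> Y \<subseteq> B" for Y by (auto intro: extI dest: extD)
  then show ?thesis using B by (auto simp: ctbl_inf_subsets_def)
qed

lemma ext_self_iff_initial_segment:
  "finite s \<Longrightarrow> Y \<in> H \<Longrightarrow> Y \<in> ext s Y \<longleftrightarrow> initial_segment enum A s Y"
  by (simp add: ext_self initial_segment_def seg_less_def)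

text \<open>\<open>copen\<close> is closed under finite intersections and arbitrary unions, so it
  suffices to test the generating sets.\<close>

lemma openin_generated_copen:
  assumes "openin (subtopology (topology_generated_by K) H) R"
    and "\<And>V. V \<in> K \<Longrightarrow> copen (V \<inter> H)"
  shows "copen R"
proof -
  obtain V where V: "openin (topology_generated_by K) V" "R = V \<inter> H"
    using assms(1) by (auto simp: openin_subtopology)
  have "generate_topology_on K V" using V(1) by (simp add: openin_topology_generated_by_iff)
  then have "copen (V \<inter> H)"
  proof induction
    case Empty
    then show ?case by (simp add: copen_def)
  next
    case (Int a b)
    then show ?case using copen_Int[of "a \<inter> H" "b \<inter> H"] by (simp add: Int_ac)
  next
    case (UN K)
    then have "copen (\<Union>((\<lambda>k. k \<inter> H) ` K))" by (intro copen_Union) auto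
    moreover have "\<Union>((\<lambda>k. k \<inter> H) ` K) = \<Union>K \<inter> H" by blast
    ultimately show ?case by simp
  next
    case (Basis s)
    then show ?case using assms(2) by blast
  qed
  then show ?thesis using V by simp
qed

lemma openin_ellentuck_iff: "openin (subtopology (ellentuck enum A) H) R \<longleftrightarrow> copen R"
proof
  assume "openin (subtopology (ellentuck enum A) H) R"
  then show "copen R" unfolding ellentuck_def
    by (rule openin_generated_copen) (auto simp only: ell_int_Int_H copen_ext)
next
  assume R: "copen R"
  show "openin (subtopology (ellentuck enum A) H) R"
  proof (subst openin_subopen, rule ballI)
    fix Y assume "Y \<in> R"
    then obtain t where t: "finite t" "Y \<in> ext t Y" "ext t Y \<subseteq> R" using R by (auto simp: copen_def)
    have YH: "Y \<in> H" and tY: "t \<subseteq> Y" using t by (auto simp: ext_def)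
    \<comment> \<open>The generators of \<open>ellentuck\<close> require the infinite part to lie
      above the stem, so \<open>Y - t\<close> takes the place of \<open>Y\<close>; the relative
      basic set is the same.\<close>
    have "Y - t \<in> ctbl_inf_subsets A" using Diff_finite[OF YH t(1)] by blast
    moreover have "seg_less enum A t (Y - t)" using extD(4)[OF t(2)] by (auto simp: seg_less_def)
    moreover have "t \<subseteq> A" using tY carrier[OF YH] by blast
    ultimately have "ell_int enum A t (Y - t) \<in> {ell_int enum A s B | s B. finite s \<and> s \<subseteq> A \<and>
        B \<in> ctbl_inf_subsets A \<and> (s = {} \<or> seg_less enum A s B)}"
      using t(1) by blast
    then have "openin (ellentuck enum A) (ell_int enum A t (Y - t))"
      unfolding ellentuck_def by (rule topology_generated_by_Basis)
    then have "openin (subtopology (ellentuck enum A) H) (ell_int enum A t (Y - t) \<inter> H)"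
      by (auto simp: openin_subtopology)
    moreover have "ext t (Y - t) = ext t Y" by (auto simp: ext_def above_def)
    ultimately show "\<exists>T. openin (subtopology (ellentuck enum A) H) T \<and> Y \<in> T \<and> T \<subseteq> R"
      using t by (metis ell_int_Int_H)
  qed
qed

text \<open>Membership of \<open>Y\<close> in a cylinder over \<open>F\<close> is settled by the
  initial segment \<open>t\<close> of \<open>Y\<close> up to the last index of \<open>F\<close>: any
  \<open>Z\<close> in \<open>ext t Y\<close> satisfies \<open>t \<subseteq> Z \<subseteq> Y\<close>
  and so agrees with \<open>Y\<close> on \<open>F\<close>.\<close>

lemma openin_cantor_copen:
  assumes "openin (subtopology (cantor_top A) H) R" shows "copen R"
  using assms unfolding cantor_top_def
proof (rule openin_generated_copen)
  fix V assume "V \<in> {{D. D \<subseteq> A \<and> D \<inter> F = G} | F G. finite F \<and> F \<subseteq> A \<and> G \<subseteq> F}"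
  then obtain F G where V: "V = {D. D \<subseteq> A \<and> D \<inter> F = G}" and F: "finite F" "F \<subseteq> A" by blast
  show "copen (V \<inter> H)" unfolding copen_def
  proof (intro conjI ballI)
    fix Y assume Y: "Y \<in> V \<inter> H"
    define t where "t = {x\<in>Y. \<exists>y\<in>F. idx enum A x \<le> idx enum A y}"
    have "finite t" unfolding t_def
      by (rule finite_subset[OF _ finite_not_above[OF F(1)]]) (use Y V in auto)
    moreover have "idx enum A x < idx enum A y" if xy: "x \<in> t" "y \<in> Y - t" for x y
    proof -
      obtain z where z: "z \<in> F" "idx enum A x \<le> idx enum A z" using xy by (auto simp: t_def)
      moreover have "\<not> idx enum A y \<le> idx enum A z" using xy z(1) by (auto simp: t_def)
      ultimately show ?thesis by simp
    qed
    then have "Y \<in> ext t Y" using Y by (subst ext_self) (auto simp: t_def)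
    moreover have "Z \<in> V \<inter> H" if Z: "Z \<in> ext t Y" for Z
    proof -
      have ZH: "Z \<in> H" and "t \<subseteq> Z" "Z - t \<subseteq> Y" using Z by (auto simp: ext_def above_def)
      moreover have "Y \<inter> F \<subseteq> t" by (auto simp: t_def)
      moreover have "t \<subseteq> Y" by (auto simp: t_def)
      ultimately have "Z \<inter> F = Y \<inter> F" by blast
      then show ?thesis using Y V ZH carrier[OF ZH] by simp
    qed
    ultimately show "\<exists>t. finite t \<and> Y \<in> ext t Y \<and> ext t Y \<subseteq> V \<inter> H" by blast
  qed blast
qed

text \<open>If \<open>F\<close> holds \<open>s\<close> and everything indexed up to the end of
  \<open>s\<close>, then \<open>s\<close> is an initial segment of \<open>D\<close> exactly when
  \<open>D \<inter> F = s\<close>, which is a cylinder condition.\<close>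

lemma openin_cantor_initial_segment:
  assumes "\<S> \<subseteq> finite_subsets A"
  shows "openin (subtopology (cantor_top A) H) {C\<in>H. \<exists>s\<in>\<S>. initial_segment enum A s C}"
proof (subst openin_subopen, rule ballI)
  fix Y assume "Y \<in> {C\<in>H. \<exists>s\<in>\<S>. initial_segment enum A s C}"
  then obtain s where Y: "Y \<in> H" and s: "s \<in> \<S>" "initial_segment enum A s Y" by blast
  have fs: "finite s" "s \<subseteq> A" using s assms by (auto simp: finite_subsets_def)
  define F where "F = s \<union> {x\<in>A. \<exists>y\<in>s. idx enum A x \<le> idx enum A y}"
  have F: "finite F" "F \<subseteq> A" "s \<subseteq> F" using fs finite_not_above by (auto simp: F_def)
  have eq: "D \<inter> F = s \<longleftrightarrow> initial_segment enum A s D" if "D \<subseteq> A" for D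
    using that fs unfolding F_def initial_segment_def seg_less_def
    by (auto simp: not_le[symmetric])
  have "openin (cantor_top A) {D. D \<subseteq> A \<and> D \<inter> F = s}"
    unfolding cantor_top_def by (rule topology_generated_by_Basis) (use F in blast)
  then have "openin (subtopology (cantor_top A) H) ({D. D \<subseteq> A \<and> D \<inter> F = s} \<inter> H)"
    by (auto simp: openin_subtopology)
  moreover have "Y \<in> {D. D \<subseteq> A \<and> D \<inter> F = s} \<inter> H" using Y s eq carrier[OF Y] by blast
  moreover have "{D. D \<subseteq> A \<and> D \<inter> F = s} \<inter> H \<subseteq> {C\<in>H. \<exists>s\<in>\<S>. initial_segment enum A s C}"
    using eq s by blast
  ultimately show "\<exists>T. openin (subtopology (cantor_top A) H) T \<and> Y \<in> T \<and>
      T \<subseteq> {C\<in>H. \<exists>s\<in>\<S>. initial_segment enum A s C}" by blast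
qed

text \<open>A transversal of suitable index intervals, restricted to intervals of one parity, has
  gaps longer than \<open>g\<close> prescribes.\<close>

lemma S1_sparse:
  assumes S1: "S1 (omega_covers X) (omega_covers X)" and D: "D \<in> H"
  shows "\<exists>C\<in>H. C \<subseteq> D \<and> (\<forall>x\<in>C. \<forall>y\<in>C. idx enum A x < idx enum A y \<longrightarrow> g (idx enum A x) \<le> idx enum A y)"
proof -
  \<comment> \<open>Right endpoints of the intervals. The sum makes \<open>b (Suc k)\<close>
    dominate \<open>g i\<close> for every \<open>i \<le> b k\<close> without assuming
    \<open>g\<close> monotone.\<close>
  define b where "b = rec_nat 0 (\<lambda>_ m. Suc m + (\<Sum>i\<le>m. g i))"
  have b_Suc: "b (Suc k) = Suc (b k) + (\<Sum>i\<le>b k. g i)" for k by (simp add: b_def)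
  have b_g: "g i \<le> b (Suc k)" if "i \<le> b k" for i k
    using that member_le_sum[of i "{..b k}" g] by (simp add: b_Suc)
  have b_ge: "k \<le> b k" for k by (induction k) (auto simp: b_Suc)
  \<comment> \<open>\<open>h i\<close> numbers the interval containing \<open>i\<close>:
    \<open>b (h i)\<close> is the first endpoint beyond \<open>i\<close>.\<close>
  define h where "h i = (LEAST k. i < b k)" for i
  have h: "i < b (h i)" for i
    unfolding h_def by (rule LeastI[of _ "Suc i"]) (use b_ge[of "Suc i"] in simp)
  have h_least: "b k \<le> i" if "k < h i" for i k
    using not_less_Least that unfolding h_def by (meson not_le)
  have h_mono: "h i \<le> h j" if "i \<le> j" for i j
    unfolding h_def by (rule Least_le) (use h[of j] that in \<open>simp add: h_def\<close>)
  have fib: "finite {V\<in>D. h (idx enum A V) = k}" for k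
  proof (rule finite_imageD)
    have "idx enum A ` {V\<in>D. h (idx enum A V) = k} \<subseteq> {..<b k}" using h by auto
    then show "finite (idx enum A ` {V\<in>D. h (idx enum A V) = k})" using finite_subset by blast
    show "inj_on (idx enum A) {V\<in>D. h (idx enum A V) = k}"
      using inj carrier[OF D] by (auto simp: inj_on_def)
  qed
  then obtain C where C: "C \<subseteq> D" "C \<in> omega_covers X" "inj_on (\<lambda>V. h (idx enum A V)) C"
    using S1_transversal[OF S1, of D "\<lambda>V. h (idx enum A V)"] D by blast
  have "C \<in> H" using C mem_H carrier[OF D] by blast
  moreover have "C = {V\<in>C. even (h (idx enum A V))} \<union> {V\<in>C. odd (h (idx enum A V))}" by blast
  \<comment> \<open>Points in adjacent intervals may be too close. One parity class is again in
    \<open>H\<close>, and there distinct intervals have a full interval between them.\<close>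
  ultimately have "\<exists>E\<in>H. E \<subseteq> C \<and> (\<exists>p. \<forall>V\<in>E. even (h (idx enum A V)) = p)"
    using split[of "{V\<in>C. even (h (idx enum A V))}" "{V\<in>C. odd (h (idx enum A V))}"]
    by (smt (verit, best) mem_Collect_eq subsetI)
  then obtain E p where E: "E \<in> H" "E \<subseteq> C" "\<And>V. V \<in> E \<Longrightarrow> even (h (idx enum A V)) = p" by blast
  have "g (idx enum A x) \<le> idx enum A y" if "x \<in> E" "y \<in> E" "idx enum A x < idx enum A y" for x y
  proof -
    have "h (idx enum A x) \<noteq> h (idx enum A y)" using C(3) that E(2) by (auto dest!: inj_onD)
    moreover have "h (idx enum A x) \<le> h (idx enum A y)" using h_mono that by simp
    moreover have "even (h (idx enum A x)) = even (h (idx enum A y))" using E that by blast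
    ultimately have "Suc (h (idx enum A x)) < h (idx enum A y)"
      by (metis Suc_lessI even_Suc le_neq_implies_less)
    then have "b (Suc (h (idx enum A x))) \<le> idx enum A y" by (rule h_least)
    then show ?thesis using b_g[OF less_imp_le[OF h]] by (rule order_trans[rotated])
  qed
  then have "\<forall>x\<in>E. \<forall>y\<in>E. idx enum A x < idx enum A y \<longrightarrow> g (idx enum A x) \<le> idx enum A y" by blast
  moreover have "E \<subseteq> D" using E(2) C(1) by blast
  ultimately show ?thesis using E(1) by blast
qed

text \<open>The gap function exceeds the indices of all \<open>T k\<close> with
  \<open>k \<le> m\<close>. A point of \<open>C\<close> beyond \<open>x\<close> is therefore some
  \<open>T k\<close> with \<open>k > idx enum A x\<close>, and monotonicity of \<open>U\<close> puts
  it into \<open>U (idx enum A x)\<close>.\<close>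

lemma S1_selective:
  assumes S1: "S1 (omega_covers X) (omega_covers X)"
  shows "selective_coideal (idx enum A) A H"
proof
  fix U :: "nat \<Rightarrow> 'a set set"
  assume U: "\<And>n. U n \<in> H" "decseq U"
  then obtain T where T: "\<And>n. T n \<in> U n" "range T \<in> omega_covers X"
    using S1 unfolding S1_def by (meson IntD2)
  have TU: "T n \<in> U m" if "m \<le> n" for m n using T(1) decseqD[OF U(2) that] by blast
  have "range T \<in> H" using T U carrier mem_H by (meson image_subset_iff subsetD)
  then obtain C where C: "C \<in> H" "C \<subseteq> range T"
    "\<And>x y. x \<in> C \<Longrightarrow> y \<in> C \<Longrightarrow> idx enum A x < idx enum A y \<Longrightarrow>
       Suc (\<Sum>k\<le>idx enum A x. idx enum A (T k)) \<le> idx enum A y"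
    using S1_sparse[OF S1 \<open>range T \<in> H\<close>, of "\<lambda>m. Suc (\<Sum>k\<le>m. idx enum A (T k))"] by metis
  have "y \<in> U (idx enum A x)" if xy: "x \<in> C" "y \<in> C" "idx enum A x < idx enum A y" for x y
  proof -
    obtain k where k: "y = T k" using C(2) xy(2) by blast
    have "\<not> k \<le> idx enum A x"
    proof
      assume "k \<le> idx enum A x"
      then have "idx enum A y \<le> (\<Sum>k\<le>idx enum A x. idx enum A (T k))"
        using k member_le_sum[of k "{..idx enum A x}" "\<lambda>k. idx enum A (T k)"] by simp
      then show False using C(3)[OF xy] by simp
    qed
    then show ?thesis using TU k by simp
  qed
  then show "\<exists>D\<in>H. D \<subseteq> U 0 \<and> (\<forall>x\<in>D. above {x} D \<subseteq> U (idx enum A x))"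
    using C TU by (intro bexI[of _ C]) (auto simp: above_def)
qed

end

section \<open>From partition relations to selection\<close>

lemma arrow_homE:
  fixes f :: "'b set \<Rightarrow> nat"
  assumes "arrow_hom \<A> \<B> m k" "A \<in> \<A>" "\<forall>Y\<in>[A]\<^bsup>m\<^esup>. f Y \<in> {1..k}"
  obtains i B where "i \<in> {1..k}" "B \<subseteq> A" "B \<in> \<B>" "\<forall>Y\<in>[B]\<^bsup>m\<^esup>. f Y = i"
  using mp[OF spec[OF bspec[OF assms(1)[unfolded arrow_hom_def] assms(2)], of f] assms(3)]
  by (elim bexE exE conjE)

lemma arrow_twoE:
  fixes f :: "'b set \<Rightarrow> nat"
  assumes "arrow_two \<A> \<B> \<C> m" "A \<in> \<A>" "\<forall>Y\<in>[A]\<^bsup>m\<^esup>. f Y \<in> {1,2}"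
  obtains B where "B \<subseteq> A" "B \<in> \<B>" "\<forall>Y\<in>[B]\<^bsup>m\<^esup>. f Y = 1"
    | B where "B \<subseteq> A" "B \<in> \<C>" "\<forall>Y\<in>[B]\<^bsup>m\<^esup>. f Y = 2"
  using mp[OF spec[OF bspec[OF assms(1)[unfolded arrow_two_def] assms(2)], of f] assms(3)]
  by (elim exE conjE disjE)

lemma omega_cover_Int:
  fixes V :: "'i \<Rightarrow> 'a set" and U :: "'i \<Rightarrow> 'a set set"
  assumes V: "range V \<in> omega_covers X" and U: "\<And>i. U i \<in> omega_covers X"
  shows "{V i \<inter> u | i u. u \<in> U i} \<in> omega_covers X"
proof (rule omega_coverI)
  fix W assume "W \<in> {V i \<inter> u | i u. u \<in> U i}"
  then show "openin X W" using omega_coverD(1)[OF V] omega_coverD(1)[OF U] by auto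
next
  show "topspace X \<notin> {V i \<inter> u | i u. u \<in> U i}"
  proof
    assume "topspace X \<in> {V i \<inter> u | i u. u \<in> U i}"
    then obtain i u where "topspace X = V i \<inter> u" by blast
    then show False using omega_cover_proper[OF V, of "V i"] by blast
  qed
next
  fix F assume F: "finite F" "F \<subseteq> topspace X"
  obtain i where "F \<subseteq> V i" using omega_coverD(3)[OF V F] by blast
  moreover obtain u where "u \<in> U i" "F \<subseteq> u" using omega_coverD(3)[OF U F] by blast
  ultimately have "V i \<inter> u \<in> {V i \<inter> u | i u. u \<in> U i}" "F \<subseteq> V i \<inter> u" by blast+
  then show "\<exists>W\<in>{V i \<inter> u | i u. u \<in> U i}. F \<subseteq> W" by (rule bexI[rotated])
qed

text \<open>\<open>range T\<close> coarsens \<open>B\<close>, so finite sets remain covered, and the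
  space itself is absent because it belongs to no \<open>U n\<close>.\<close>

lemma selection_from_refinement:
  fixes \<rho> :: "'a set \<Rightarrow> nat"
  assumes U: "\<And>n. U n \<in> omega_covers X" and B: "B \<in> omega_covers X"
    and sel: "\<And>n. \<exists>u\<in>U n. \<forall>W\<in>B. \<rho> W = n \<longrightarrow> W \<subseteq> u"
  shows "\<exists>T. (\<forall>n. T n \<in> U n) \<and> range T \<in> omega_covers X"
proof -
  obtain T where T: "\<And>n. T n \<in> U n" "\<And>n W. W \<in> B \<Longrightarrow> \<rho> W = n \<Longrightarrow> W \<subseteq> T n"
    using sel by metis
  have "range T \<in> omega_covers X"
  proof (rule omega_coverI)
    fix F assume "finite F" "F \<subseteq> topspace X"
    then obtain W where "W \<in> B" "F \<subseteq> W" using omega_coverD(3)[OF B] by blast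
    then show "\<exists>V\<in>range T. F \<subseteq> V" using T(2) by blast
  next
    fix V assume "V \<in> range T"
    then obtain n where "V = T n" by blast
    then show "openin X V" using T(1) omega_coverD(1)[OF U] by blast
  next
    show "topspace X \<notin> range T"
    proof
      assume "topspace X \<in> range T"
      then obtain n where "topspace X = T n" by blast
      then show False using T(1)[of n] omega_coverD(2)[OF U, of n] by simp
    qed
  qed
  then show ?thesis using T by blast
qed

lemma selection_from_transversal:
  fixes \<rho> :: "'a set \<Rightarrow> nat"
  assumes U: "\<And>n. U n \<in> omega_covers X" and B: "B \<in> omega_covers X"
    and \<rho>: "inj_on \<rho> B" "\<And>W. W \<in> B \<Longrightarrow> \<exists>u\<in>U (\<rho> W). W \<subseteq> u"
  shows "\<exists>T. (\<forall>n. T n \<in> U n) \<and> range T \<in> omega_covers X"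
proof (rule selection_from_refinement[OF U B])
  fix n
  show "\<exists>u\<in>U n. \<forall>W\<in>B. \<rho> W = n \<longrightarrow> W \<subseteq> u"
  proof (cases "\<exists>W\<in>B. \<rho> W = n")
    case True
    then obtain W where "W \<in> B" "\<rho> W = n" by blast
    moreover from this obtain u where "u \<in> U n" "W \<subseteq> u" using \<rho>(2) by blast
    ultimately show ?thesis using \<rho>(1) by (metis inj_onD)
  next
    case False
    then show ?thesis using omega_coverD(3)[OF U, of "{}" n] by blast
  qed
qed

text \<open>This excludes subcovers living on finitely many levels, since a member at level
  \<open>i\<close> is contained in \<open>V i\<close>.\<close>

lemma not_omega_cover_finite_bound:
  assumes B: "B \<in> omega_covers X" and V: "range V \<in> omega_covers X" and I: "finite I"
  shows "\<exists>W\<in>B. \<forall>i\<in>I. \<not> W \<subseteq> V i"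
proof -
  have "\<exists>x\<in>topspace X. x \<notin> K" if "K \<in> V ` I" for K
    using omega_cover_proper[OF V, of K] that by blast
  then have "\<exists>W\<in>B. {} \<subseteq> W \<and> (\<forall>K\<in>V ` I. \<not> W \<subseteq> K)"
    using omega_cover_avoid[OF B, of "V ` I" "{}"] I by simp
  then show ?thesis by simp
qed

context
  fixes X :: "'a topology"
  assumes ctbl: "\<forall>U\<in>omega_covers X. \<exists>V. V \<subseteq> U \<and> countable V \<and> V \<in> omega_covers X"
begin

lemma omega_cover_sequence:
  assumes "U \<in> omega_covers X"
  shows "\<exists>V. range (V :: nat \<Rightarrow> 'a set) \<subseteq> U \<and> range V \<in> omega_covers X"
proof -
  obtain C where C: "C \<subseteq> U" "countable C" "C \<in> omega_covers X" using ctbl assms by blast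
  then have "range (from_nat_into C) = C"
    using omega_cover_infinite[OF C(3)] by (intro range_from_nat_into) auto
  then show ?thesis using C by metis
qed

text \<open>A set may have the form \<open>V n \<inter> u\<close> for several \<open>n\<close>;
  \<open>\<rho>\<close> fixes one such level. Only two inclusions are kept: the one in
  \<open>V\<close> bounds levels, the one in \<open>U\<close> produces the selection.\<close>

lemma two_level_refinement:
  assumes U: "\<And>n::nat. U n \<in> omega_covers X"
  obtains V A and \<rho> :: "'a set \<Rightarrow> nat" where "range V \<in> omega_covers X" "A \<in> omega_covers X"
    "\<And>W. W \<in> A \<Longrightarrow> W \<subseteq> V (\<rho> W)" "\<And>W. W \<in> A \<Longrightarrow> \<exists>u\<in>U (\<rho> W). W \<subseteq> u"
proof -
  obtain V :: "nat \<Rightarrow> 'a set" where V: "range V \<in> omega_covers X"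
    using omega_cover_sequence[OF U[of 0]] by blast
  define A where "A = {V n \<inter> u | n u. u \<in> U n}"
  have "\<forall>W\<in>A. \<exists>n. W \<subseteq> V n \<and> (\<exists>u\<in>U n. W \<subseteq> u)" unfolding A_def by blast
  then obtain \<rho> where \<rho>: "\<forall>W\<in>A. W \<subseteq> V (\<rho> W) \<and> (\<exists>u\<in>U (\<rho> W). W \<subseteq> u)" by metis
  have "A \<in> omega_covers X" unfolding A_def by (rule omega_cover_Int[OF V U])
  then show ?thesis using that[OF V, of A \<rho>] \<rho> by simp
qed

text \<open>Pairs are coloured 1 when their levels differ. Colour 2 confines a set to one level
  \<open>n\<close>, hence to the proper subset \<open>V n\<close>, so not even an open cover can be
  homogeneous for it; colour 1 leaves a transversal.\<close>

lemma arrow_open_covers_imp_S1: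
  assumes arrow: "arrow_two (omega_covers X) (omega_covers X) (open_covers X) 2"
  shows "S1 (omega_covers X) (omega_covers X)"
  unfolding S1_def
proof (intro allI impI)
  fix U :: "nat \<Rightarrow> 'a set set" assume "\<forall>n. U n \<in> omega_covers X"
  then have U: "\<And>n. U n \<in> omega_covers X" by blast
  obtain V A and \<rho> :: "'a set \<Rightarrow> nat" where V: "range V \<in> omega_covers X" and A: "A \<in> omega_covers X"
    and \<rho>: "\<And>W. W \<in> A \<Longrightarrow> W \<subseteq> V (\<rho> W)" "\<And>W. W \<in> A \<Longrightarrow> \<exists>u\<in>U (\<rho> W). W \<subseteq> u"
    using two_level_refinement[of U, OF U] by metis
  define f :: "'a set set \<Rightarrow> nat" where "f Y = (if inj_on \<rho> Y then 1 else 2)" for Y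
  have f12: "\<forall>Y\<in>[A]\<^bsup>2\<^esup>. f Y \<in> {1,2}" by (simp add: f_def)
  have pair: "f {W, W'} = (if \<rho> W = \<rho> W' then 2 else 1)" "{W, W'} \<in> [B]\<^bsup>2\<^esup>"
    if "W \<in> B" "W' \<in> B" "W \<noteq> W'" for W W' and B :: "'a set set"
    using that by (auto simp: f_def doubleton_in_nsets_2)
  show "\<exists>T. (\<forall>n. T n \<in> U n) \<and> range T \<in> omega_covers X"
  proof (rule arrow_twoE[OF arrow A f12])
    fix B assume B: "B \<subseteq> A" and hom: "B \<in> omega_covers X" "\<forall>Y\<in>[B]\<^bsup>2\<^esup>. f Y = 1"
    have "inj_on \<rho> B"
    proof (rule inj_onI, rule ccontr)
      fix W W' assume W: "W \<in> B" "W' \<in> B" "\<rho> W = \<rho> W'" "W \<noteq> W'"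
      then have "f {W, W'} = 1" by (intro bspec[OF hom(2)] pair(2))
      then show False using pair(1)[OF W(1,2,4)] W(3) by simp
    qed
    moreover have "\<exists>u\<in>U (\<rho> W). W \<subseteq> u" if "W \<in> B" for W using \<rho>(2) B(1) that by blast
    ultimately show ?thesis using selection_from_transversal[where U = U and B = B and \<rho> = \<rho>, OF U] hom by simp
  next
    fix B assume B: "B \<subseteq> A" and hom: "B \<in> open_covers X" "\<forall>Y\<in>[B]\<^bsup>2\<^esup>. f Y = 2"
    have const: "\<rho> W = \<rho> W'" if W: "W \<in> B" "W' \<in> B" for W W'
    proof (rule ccontr)
      assume ne: "\<rho> W \<noteq> \<rho> W'"
      then have "W \<noteq> W'" by auto
      moreover from this have "f {W, W'} = 2" using W by (intro bspec[OF hom(2)] pair(2))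
      ultimately show False using pair(1)[OF W] ne by simp
    qed
    have "\<exists>n. \<forall>W\<in>B. \<rho> W = n"
    proof (cases "B = {}")
      case False
      then obtain w where "w \<in> B" by blast
      then have "\<forall>W\<in>B. \<rho> W = \<rho> w" using const by blast
      then show ?thesis ..
    qed simp
    then obtain n where n: "\<forall>W\<in>B. \<rho> W = n" ..
    have "W \<subseteq> V n" if "W \<in> B" for W using \<rho>(1)[of W] n B that by auto
    then have "\<Union>B \<subseteq> V n" by (rule Union_least)
    then have False using omega_cover_proper[OF V, of "V n"] hom by (auto simp: open_covers_def)
    then show ?thesis ..
  qed
qed

text \<open>A triple is coloured 2 if its two members of lowest level share that level and the third lies
  strictly above; no four-element set has only such triples.\<close>
lemma arrow_4_imp_S1:
  assumes arrow: "arrow_two (omega_covers X) (omega_covers X) {B. finite B \<and> card B = 4} 3"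
  shows "S1 (omega_covers X) (omega_covers X)"
  unfolding S1_def
proof (intro allI impI)
  fix U :: "nat \<Rightarrow> 'a set set" assume "\<forall>n. U n \<in> omega_covers X"
  then have U: "\<And>n. U n \<in> omega_covers X" by blast
  obtain V A and \<rho> :: "'a set \<Rightarrow> nat" where V: "range V \<in> omega_covers X" and A: "A \<in> omega_covers X"
    and \<rho>: "\<And>W. W \<in> A \<Longrightarrow> W \<subseteq> V (\<rho> W)" "\<And>W. W \<in> A \<Longrightarrow> \<exists>u\<in>U (\<rho> W). W \<subseteq> u"
    using two_level_refinement[of U, OF U] by metis
  define f :: "'a set set \<Rightarrow> nat"
    where "f Y = (if \<exists>a b c. Y = {a, b, c} \<and> \<rho> a = \<rho> b \<and> \<rho> b < \<rho> c then 2 else 1)" for Y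
  have triple: "{a, b, c} \<in> [B]\<^bsup>3\<^esup>" if "a \<in> B" "b \<in> B" "c \<in> B" "a \<noteq> b" "a \<noteq> c" "b \<noteq> c"
    for a b c and B :: "'a set set"
    using that by (auto simp: nsets_def)
  have f12: "\<forall>Y\<in>[A]\<^bsup>3\<^esup>. f Y \<in> {1,2}" by (simp add: f_def)
  show "\<exists>T. (\<forall>n. T n \<in> U n) \<and> range T \<in> omega_covers X"
  proof (rule arrow_twoE[OF arrow A f12])
    fix B assume B: "B \<subseteq> A" and hom: "B \<in> omega_covers X" "\<forall>Y\<in>[B]\<^bsup>3\<^esup>. f Y = 1"
    have "inj_on \<rho> B"
    proof (rule inj_onI, rule ccontr)
      fix a b assume ab: "a \<in> B" "b \<in> B" "\<rho> a = \<rho> b" "a \<noteq> b"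
      \<comment> \<open>Two members on one level can always be completed to a triple of colour 2 by
        a member of higher level.\<close>
      obtain c where c: "c \<in> B" "\<forall>i\<in>{..\<rho> b}. \<not> c \<subseteq> V i"
        using not_omega_cover_finite_bound[OF hom(1) V, of "{..\<rho> b}"] by blast
      have "\<not> \<rho> c \<le> \<rho> b" using \<rho>(1)[of c] c B by auto
      then have "f {a, b, c} = 2" using ab unfolding f_def by (auto simp: not_le)
      moreover have "{a, b, c} \<in> [B]\<^bsup>3\<^esup>" using ab c(1) \<open>\<not> \<rho> c \<le> \<rho> b\<close> by (intro triple) auto
      ultimately show False using hom(2) by auto
    qed
    moreover have "\<exists>u\<in>U (\<rho> W). W \<subseteq> u" if "W \<in> B" for W using \<rho>(2) B(1) that by blast
    ultimately show ?thesis using selection_from_transversal[where U = U and B = B and \<rho> = \<rho>, OF U] hom by simp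
  next
    fix B assume B: "B \<in> {B. finite B \<and> card B = 4}" and hom: "\<forall>Y\<in>[B]\<^bsup>3\<^esup>. f Y = 2"
    have two: "\<rho> a = \<rho> b \<and> \<rho> b < \<rho> c \<or> \<rho> a = \<rho> c \<and> \<rho> c < \<rho> b \<or> \<rho> b = \<rho> c \<and> \<rho> c < \<rho> a"
      if abc: "a \<in> B" "b \<in> B" "c \<in> B" "a \<noteq> b" "a \<noteq> c" "b \<noteq> c" for a b c
    proof -
      have "f {a, b, c} = 2" using bspec[OF hom triple[OF abc]] .
      then have "\<exists>x y z. {a, b, c} = {x, y, z} \<and> \<rho> x = \<rho> y \<and> \<rho> y < \<rho> z"
        unfolding f_def by (rule contrapos_pp) simp
      then obtain x y z where xyz: "{a, b, c} = {x, y, z}" "\<rho> x = \<rho> y" "\<rho> y < \<rho> z"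
        by (elim exE conjE)
      have "x \<noteq> y"
      proof
        assume "x = y"
        then have "{a, b, c} = {y, z}" using xyz(1) by simp
        moreover have "card {a, b, c} = 3" using abc by simp
        moreover have "card {y, z} \<le> 2" by (simp add: card_insert_if)
        ultimately show False by simp
      qed
      moreover have "x \<in> {a, b, c}" "y \<in> {a, b, c}" "z \<in> {a, b, c}" unfolding xyz(1) by simp_all
      ultimately show ?thesis using xyz(2,3) by auto
    qed
    obtain a b c d where abcd: "B = {a, b, c, d}" "a \<noteq> b" "a \<noteq> c" "a \<noteq> d" "b \<noteq> c" "b \<noteq> d" "c \<noteq> d"
      using B by (auto simp: card_Suc_eq numeral_eq_Suc)
    then have B4: "a \<in> B" "b \<in> B" "c \<in> B" "d \<in> B" by simp_all
    \<comment> \<open>Set aside an element of highest level. The other three have levels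
      \<open>l, l, h\<close> with \<open>l < h\<close>; a low one, the high one and the element set
      aside then form a triple whose lowest level occurs only once.\<close>
    have False
      using two[OF B4(1,2,3) abcd(2,3,5)] two[OF B4(1,2,4) abcd(2,4,6)]
        two[OF B4(1,3,4) abcd(3,4,7)] two[OF B4(2,3,4) abcd(5,6,7)] by auto
    then show ?thesis ..
  qed
qed

text \<open>The three colours record the first of three levels at which two members separate; the covers \<open>U n\<close>
  are used both at the second and, through a pairing function, at the third level.\<close>
lemma arrow_sq_imp_S1:
  assumes arrow: "arrow_sq (omega_covers X) (omega_covers X) 2 3 2"
  shows "S1 (omega_covers X) (omega_covers X)"
  unfolding S1_def
proof (intro allI impI)
  fix U :: "nat \<Rightarrow> 'a set set" assume "\<forall>n. U n \<in> omega_covers X"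
  then have U: "\<And>n. U n \<in> omega_covers X" by blast
  obtain V :: "nat \<Rightarrow> 'a set" where V: "range V \<in> omega_covers X"
    using omega_cover_sequence[OF U[of 0]] by blast
  have "\<forall>n. \<exists>v. range (v :: nat \<Rightarrow> 'a set) \<subseteq> U n \<and> range v \<in> omega_covers X"
    using omega_cover_sequence[OF U] by blast
  then obtain v :: "nat \<Rightarrow> nat \<Rightarrow> 'a set"
    where v: "\<And>n. range (v n) \<subseteq> U n" "\<And>n. range (v n) \<in> omega_covers X" by metis
  \<comment> \<open>The second-level sets \<open>v n m\<close> are themselves members of
    \<open>U n\<close>, so a single one of them can serve as the choice from
    \<open>U n\<close>.\<close>
  define A where "A = {V n \<inter> w | n w. w \<in> {v n m \<inter> u | m u. u \<in> U (prod_encode (n, m))}}"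
  have A: "A \<in> omega_covers X"
    unfolding A_def by (intro omega_cover_Int V v(2) U)
  have "\<forall>W\<in>A. \<exists>n m. W \<subseteq> V n \<and> W \<subseteq> v n m \<and> (\<exists>u\<in>U (prod_encode (n, m)). W \<subseteq> u)"
    unfolding A_def by blast
  then obtain p q where pq: "\<And>W. W \<in> A \<Longrightarrow> W \<subseteq> V (p W)" "\<And>W. W \<in> A \<Longrightarrow> W \<subseteq> v (p W) (q W)"
    "\<And>W. W \<in> A \<Longrightarrow> \<exists>u\<in>U (prod_encode (p W, q W)). W \<subseteq> u" by metis
  define f :: "'a set set \<Rightarrow> nat"
    where "f Y = (if \<exists>x\<in>Y. \<exists>y\<in>Y. p x \<noteq> p y then 1 else if \<exists>x\<in>Y. \<exists>y\<in>Y. q x \<noteq> q y then 2 else 3)" for Y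
  have "\<forall>Y\<in>[A]\<^bsup>2\<^esup>. f Y \<in> {1..3}" by (simp add: f_def)
  then obtain B where B: "B \<subseteq> A" "B \<in> omega_covers X" "card (f ` [B]\<^bsup>2\<^esup>) \<le> 2"
    using arrow A unfolding arrow_sq_def by blast
  have "f ` [B]\<^bsup>2\<^esup> \<noteq> {1, 2, 3}"
  proof
    assume "f ` [B]\<^bsup>2\<^esup> = {1, 2, 3}"
    then show False using B(3) by simp
  qed
  moreover have "f ` [B]\<^bsup>2\<^esup> \<subseteq> {1, 2, 3}" by (auto simp: f_def)
  ultimately consider "1 \<notin> f ` [B]\<^bsup>2\<^esup>" | "2 \<notin> f ` [B]\<^bsup>2\<^esup>" | "3 \<notin> f ` [B]\<^bsup>2\<^esup>" by blast
  moreover have pair: "(if p x \<noteq> p y then 1 else if q x \<noteq> q y then 2 else 3) \<in> f ` [B]\<^bsup>2\<^esup>"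
    if "x \<in> B" "y \<in> B" "x \<noteq> y" for x y
  proof -
    have "f {x, y} = (if p x \<noteq> p y then 1 else if q x \<noteq> q y then 2 else 3)" by (auto simp: f_def)
    moreover have "{x, y} \<in> [B]\<^bsup>2\<^esup>" using that by (simp add: doubleton_in_nsets_2)
    ultimately show ?thesis by (metis imageI)
  qed
  ultimately show "\<exists>T. (\<forall>n. T n \<in> U n) \<and> range T \<in> omega_covers X"
  proof cases
    case c: 1
    have 1: "p x = p y" if "x \<in> B" "y \<in> B" for x y
      using pair[OF that] c by (cases "x = y") (auto split: if_splits)
    obtain x where x: "x \<in> B" using omega_coverD(3)[OF B(2), of "{}"] by blast
    obtain W where "W \<in> B" "\<not> W \<subseteq> V (p x)"
      using not_omega_cover_finite_bound[OF B(2) V, of "{p x}"] by blast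
    then have False using 1[OF x, of W] pq(1) B(1) by auto
    then show ?thesis ..
  next
    case c: 2
    \<comment> \<open>Without colour 2, \<open>q\<close> is determined by \<open>p\<close> on
      \<open>B\<close>, so all members with \<open>p W = n\<close> lie in one
      \<open>v n m\<close>.\<close>
    have 2: "q x = q y" if "x \<in> B" "y \<in> B" "p x = p y" for x y
      using pair[OF that(1,2)] that(3) c by (cases "x = y") (auto split: if_splits)
    show ?thesis
    proof (rule selection_from_refinement[where U = U and B = B and \<rho> = p, OF U B(2)])
      fix n
      show "\<exists>u\<in>U n. \<forall>W\<in>B. p W = n \<longrightarrow> W \<subseteq> u"
      proof (cases "\<exists>x\<in>B. p x = n")
        case True
        then obtain x where x: "x \<in> B" "p x = n" by blast
        have "W \<subseteq> v n (q x)" if "W \<in> B" "p W = n" for W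
          using 2[OF that(1) x(1)] x(2) that pq(2)[of W] B(1) by auto
        moreover have "v n (q x) \<in> U n" using v(1)[of n] by blast
        ultimately show ?thesis by (intro bexI[of _ "v n (q x)"]) simp_all
      next
        case False
        then show ?thesis using omega_coverD(3)[OF U, of "{}" n] by blast
      qed
    qed
  next
    case c: 3
    \<comment> \<open>Without colour 3 the pair of levels identifies the member, and the third-level
      covers, indexed by the coded pair, give the selection.\<close>
    have 3: "x = y" if "x \<in> B" "y \<in> B" "p x = p y" "q x = q y" for x y
      using pair[OF that(1,2)] that(3,4) c by auto
    have "inj_on (\<lambda>W. prod_encode (p W, q W)) B"
      by (intro inj_onI 3) simp_all
    moreover have "\<exists>u\<in>U (prod_encode (p W, q W)). W \<subseteq> u" if "W \<in> B" for W
      using pq(3) B(1) that by blast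
    ultimately show ?thesis
      by (rule selection_from_transversal[where U = U and B = B, OF U B(2)])
  qed
qed

end

section \<open>The equivalences\<close>

text \<open>Initial segments of one set form a chain, and inclusion between finite sets of equal
  size is equality.\<close>

lemma initial_segments_card_eq:
  assumes "initial_segment enum A s C" "initial_segment enum A t C" "card s = card t"
  shows "s = t"
proof -
  have "s \<subseteq> t \<or> t \<subseteq> s"
  proof (rule ccontr)
    assume "\<not> ?thesis"
    then obtain x y where "x \<in> s - t" "y \<in> t - s" by blast
    then have "idx enum A x < idx enum A y" "idx enum A y < idx enum A x"
      using assms(1,2) unfolding initial_segment_def seg_less_def by blast+
    then show False by simp
  qed
  then show ?thesis using assms card_subset_eq unfolding initial_segment_def by metis
qed

context
  fixes X :: "'a topology" and enum :: "'a set set \<Rightarrow> nat \<Rightarrow> 'a set"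
  assumes ctbl: "\<forall>U\<in>omega_covers X. \<exists>V. V \<subseteq> U \<and> countable V \<and> V \<in> omega_covers X"
    and enum: "\<forall>A. countable A \<and> infinite A \<longrightarrow> bij_betw (enum A) UNIV A"
begin

lemma ctbl_omega_cover: "A \<in> omega_covers X \<Longrightarrow> countable A \<Longrightarrow> ctbl_omega_cover X enum A"
  using enum omega_cover_infinite by unfold_locales blast+

lemma S1_imp_E:
  assumes S1: "S1 (omega_covers X) (omega_covers X)"
  shows "E_Omega X enum"
  unfolding E_Omega_def
proof (intro ballI impI allI, elim conjE)
  fix A R S s
  assume A: "A \<in> omega_covers X" "countable A"
    and R: "baire_property_in (subtopology (ellentuck enum A) (ctbl_inf_subsets A \<inter> omega_covers X)) R"
    and S: "S \<subseteq> A" "S \<in> omega_covers X" and s: "finite s" "s \<subseteq> A"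
  interpret ctbl_omega_cover X enum A using ctbl_omega_cover A by blast
  interpret selective_coideal "idx enum A" A H using S1_selective[OF S1] .
  have "S \<in> H" using S mem_H by blast
  then obtain B where B: "B \<in> H" "B \<subseteq> above s S" "ext s B \<subseteq> R \<or> ext s B \<inter> R = {}"
    using ellentuck_ramsey[OF openin_ellentuck_iff R _ s] by blast
  have "B \<in> omega_covers X" using B(1) by blast
  then show "\<exists>B. infinite B \<and> B \<subseteq> restr enum A S s \<and> B \<in> omega_covers X \<and>
      (ell_int enum A s B \<inter> omega_covers X \<subseteq> R \<or> ell_int enum A s B \<inter> omega_covers X \<inter> R = {})"
    using B(2,3) infinite[OF B(1)] unfolding ext_eq_ell_int above_eq_restr by blast
qed

text \<open>Open sets of the \<open>2^A\<close> topology are Ellentuck open, hence have the Baire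
  property with empty meager part; the stem \<open>{}\<close> gives the claim.\<close>

lemma E_imp_GP:
  assumes E: "E_Omega X enum"
  shows "GP_Omega X"
  unfolding GP_Omega_def
proof (intro ballI impI allI, elim conjE)
  fix A R S
  assume A: "A \<in> omega_covers X" "countable A"
    and R: "openin (subtopology (cantor_top A) (ctbl_inf_subsets A \<inter> omega_covers X)) R"
    and S: "S \<in> ctbl_inf_subsets A \<inter> omega_covers X"
  interpret ctbl_omega_cover X enum A using ctbl_omega_cover A by blast
  have "copen R" using openin_cantor_copen[OF R] .
  then have op: "openin (subtopology (ellentuck enum A) H) R" and RH: "R \<subseteq> H"
    using openin_ellentuck_iff by (auto simp: copen_def)
  have "meager_in (subtopology (ellentuck enum A) H) {}"
    unfolding meager_in_def by (intro exI[of _ "{}"]) auto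
  then have "baire_property_in (subtopology (ellentuck enum A) H) R"
    unfolding baire_property_in_def using op by (intro exI[of _ R] exI[of _ "{}"]) auto
  moreover have SA: "S \<subseteq> A" using carrier[OF S] .
  ultimately have "\<exists>B. infinite B \<and> B \<subseteq> restr enum A S {} \<and> B \<in> omega_covers X \<and>
      (ell_int enum A {} B \<inter> omega_covers X \<subseteq> R \<or> ell_int enum A {} B \<inter> omega_covers X \<inter> R = {})"
    using E[unfolded E_Omega_def, rule_format, of A R S "{}"] A RH S omega_cover_infinite[OF A(1)]
    by simp
  then obtain B where B: "infinite B" "B \<subseteq> S" "B \<in> omega_covers X"
    "ext {} B \<subseteq> R \<or> ext {} B \<inter> R = {}"
    unfolding ext_eq_ell_int restr_def by blast
  have "B \<subseteq> A" using B(2) SA by blast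
  moreover have "B \<in> ctbl_inf_subsets S"
    using B countable_subset[OF \<open>B \<subseteq> A\<close> A(2)] by (auto simp: ctbl_inf_subsets_def)
  ultimately show "\<exists>B\<in>ctbl_inf_subsets S \<inter> omega_covers X.
      ctbl_inf_subsets B \<inter> omega_covers X \<subseteq> R \<or> ctbl_inf_subsets B \<inter> omega_covers X \<inter> R = {}"
    using B ext_empty[of B] by auto
qed

text \<open>Apply the open dichotomy to the covers with an initial segment in the dense family.
  Density refutes the negative alternative: some \<open>s\<close> of the family inside
  \<open>B\<close> heads the cover \<open>s \<union> above s B\<close>.\<close>

lemma GP_imp_FG:
  assumes GP: "GP_Omega X"
  shows "FG_Omega X enum"
  unfolding FG_Omega_def
proof (intro ballI impI allI, elim conjE)
  fix A \<S>
  assume A: "A \<in> omega_covers X" "countable A" "infinite A" and dense: "dense_fam X A \<S>"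
  interpret ctbl_omega_cover X enum A using ctbl_omega_cover A by blast
  define R where "R = {C\<in>H. \<exists>s\<in>\<S>. initial_segment enum A s C}"
  have "openin (subtopology (cantor_top A) H) R"
    unfolding R_def using dense by (intro openin_cantor_initial_segment) (simp add: dense_fam_def)
  then have "\<exists>B\<in>H. ctbl_inf_subsets B \<inter> omega_covers X \<subseteq> R \<or> ctbl_inf_subsets B \<inter> omega_covers X \<inter> R = {}"
    using GP[unfolded GP_Omega_def, rule_format, of A R A] A A_H by simp
  then obtain B where B: "B \<in> H"
    "ctbl_inf_subsets B \<inter> omega_covers X \<subseteq> R \<or> ctbl_inf_subsets B \<inter> omega_covers X \<inter> R = {}"
    by (elim bexE) (rule that)
  obtain s where s: "s \<in> \<S>" "s \<subseteq> B" "finite s"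
    using dense B(1) unfolding dense_fam_def finite_subsets_def by blast
  define C where "C = s \<union> above s B"
  have C: "C \<in> ext s B" unfolding C_def
    using Un_above_mem_ext[OF B(1) s(3)] s(2) carrier[OF B(1)] by blast
  have CH: "C \<in> H" using extD(1)[OF C] .
  have "initial_segment enum A s C"
    using ext_self_iff_initial_segment[OF s(3) CH] mem_ext_self[OF C] by blast
  then have "C \<in> R" using CH s(1) unfolding R_def by blast
  moreover have "C \<in> ctbl_inf_subsets B \<inter> omega_covers X"
    using CH s(2) above_subset by (auto simp: ctbl_inf_subsets_def C_def)
  ultimately have "ctbl_inf_subsets B \<inter> omega_covers X \<subseteq> R" using B(2) by blast
  then show "\<exists>B\<in>H. \<forall>C\<in>ctbl_inf_subsets B \<inter> omega_covers X. \<exists>s\<in>\<S>. initial_segment enum A s C"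
    using B(1) unfolding R_def by blast
qed

text \<open>Use the pairs of colour 1 as the family. If it is dense, any pair \<open>Y\<close> in
  the resulting \<open>B\<close> heads \<open>Y \<union> above Y B\<close>, whose initial segment in
  the family has two elements too and so equals \<open>Y\<close>. If it is not dense, a witness has
  only pairs of colour 2.\<close>

lemma FG_imp_arrow:
  assumes FG: "FG_Omega X enum"
  shows "arrow_hom (omega_covers X) (omega_covers X) 2 2"
  unfolding arrow_hom_def
proof (intro ballI allI impI)
  fix A' :: "'a set set" and f :: "'a set set \<Rightarrow> nat"
  assume A': "A' \<in> omega_covers X" and f: "\<forall>Y\<in>[A']\<^bsup>2\<^esup>. f Y \<in> {1..2}"
  obtain A where A: "A \<subseteq> A'" "A \<in> omega_covers X" "countable A" using ctbl A' by blast
  interpret ctbl_omega_cover X enum A using ctbl_omega_cover A by blast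
  have fA: "f Y = 1 \<or> f Y = 2" if "Y \<in> [A]\<^bsup>2\<^esup>" for Y
    using f nsets_mono[OF A(1)] that by fastforce
  define \<S> where "\<S> = {Y\<in>[A]\<^bsup>2\<^esup>. f Y = 1}"
  show "\<exists>i\<in>{1..2}. \<exists>B\<subseteq>A'. B \<in> omega_covers X \<and> (\<forall>Y\<in>[B]\<^bsup>2\<^esup>. f Y = i)"
  proof (cases "dense_fam X A \<S>")
    case True
    then have "\<exists>B\<in>H. \<forall>C\<in>ctbl_inf_subsets B \<inter> omega_covers X. \<exists>s\<in>\<S>. initial_segment enum A s C"
      using FG[unfolded FG_Omega_def, rule_format, of A \<S>] A(2,3) omega_cover_infinite[OF A(2)] by simp
    then obtain B where B: "B \<in> H"
      "\<And>C. C \<in> ctbl_inf_subsets B \<inter> omega_covers X \<Longrightarrow> \<exists>s\<in>\<S>. initial_segment enum A s C"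
      by (elim bexE) (rule that, auto)
    have "f Y = 1" if Y: "Y \<in> [B]\<^bsup>2\<^esup>" for Y
    proof -
      have fin: "finite Y" "card Y = 2" "Y \<subseteq> B" using Y by (auto simp: nsets_def)
      define C where "C = Y \<union> above Y B"
      have C: "C \<in> ext Y B" unfolding C_def
        using Un_above_mem_ext[OF B(1) fin(1)] fin(3) carrier[OF B(1)] by blast
      have CH: "C \<in> H" using extD(1)[OF C] .
      have "C \<in> ctbl_inf_subsets B \<inter> omega_covers X"
        using CH fin(3) above_subset by (auto simp: ctbl_inf_subsets_def C_def)
      then obtain s where s: "s \<in> \<S>" "initial_segment enum A s C" using B(2) by blast
      moreover have "initial_segment enum A Y C"
        using ext_self_iff_initial_segment[OF fin(1) CH] mem_ext_self[OF C] by blast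
      moreover have "card s = card Y" using s(1) fin by (simp add: \<S>_def nsets_def)
      ultimately have "s = Y" using initial_segments_card_eq by blast
      then show ?thesis using s(1) by (simp add: \<S>_def)
    qed
    moreover have "B \<subseteq> A'" "B \<in> omega_covers X" using carrier[OF B(1)] A B(1) by auto
    ultimately show ?thesis by (intro bexI[of _ 1] exI[of _ B]) auto
  next
    case False
    moreover have "\<S> \<subseteq> finite_subsets A" by (auto simp: \<S>_def finite_subsets_def nsets_def)
    ultimately obtain B where B: "B \<in> H" "\<S> \<inter> finite_subsets B = {}"
      unfolding dense_fam_def by blast
    have "f Y = 2" if Y: "Y \<in> [B]\<^bsup>2\<^esup>" for Y
    proof -
      have YA: "Y \<in> [A]\<^bsup>2\<^esup>" using Y nsets_mono[OF carrier[OF B(1)]] by blast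
      moreover have "Y \<in> finite_subsets B" using Y by (auto simp: finite_subsets_def nsets_def)
      ultimately have "f Y \<noteq> 1" using B(2) by (auto simp: \<S>_def)
      then show ?thesis using fA[OF YA] by blast
    qed
    moreover have "B \<subseteq> A'" "B \<in> omega_covers X" using carrier[OF B(1)] A B(1) by auto
    ultimately show ?thesis by (intro bexI[of _ 2] exI[of _ B]) auto
  qed
qed

lemma S1_imp_NW:
  assumes S1: "S1 (omega_covers X) (omega_covers X)"
  shows "NW_Omega X enum"
  unfolding NW_Omega_def
proof (intro ballI impI allI, elim conjE)
  fix A \<T> and n :: nat and c
  assume A: "A \<in> omega_covers X" "countable A"
    and T: "\<T> \<subseteq> finite_subsets A" "thin enum A \<T>" and n: "1 \<le> n" "\<forall>t\<in>\<T>. c t \<in> {1..n}"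
  interpret ctbl_omega_cover X enum A using ctbl_omega_cover A by blast
  interpret selective_coideal "idx enum A" A H using S1_selective[OF S1] .
  have fin: "finite t \<and> t \<subseteq> A" if "t \<in> \<T>" for t using that T(1) by (auto simp: finite_subsets_def)
  have "\<exists>B\<in>H. B \<subseteq> A \<and> (\<exists>i\<in>{1..n}. \<forall>t\<in>\<T>. t \<subseteq> B \<longrightarrow> c t = i)"
  proof (rule nash_williams)
    fix t u assume "t \<in> \<T>" "u \<in> \<T>" "t \<subseteq> u" "\<forall>x\<in>t. \<forall>y\<in>u - t. idx enum A x < idx enum A y"
    then show "t = u" using T(2) fin unfolding thin_def initial_segment_def seg_less_def by blast
  qed (use fin A_H n in auto)
  then obtain B where B: "B \<in> H" "\<exists>i\<in>{1..n}. \<forall>t\<in>\<T>. t \<subseteq> B \<longrightarrow> c t = i"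
    by (elim bexE conjE) (rule that, assumption, rule bexI)
  from B(2) have "\<exists>i\<in>{1..n}. \<forall>t\<in>finite_subsets B \<inter> \<T>. c t = i"
  proof (elim bexE)
    fix i assume i: "i \<in> {1..n}" "\<forall>t\<in>\<T>. t \<subseteq> B \<longrightarrow> c t = i"
    then have "\<forall>t\<in>finite_subsets B \<inter> \<T>. c t = i" by (simp add: finite_subsets_def)
    then show ?thesis using i(1) by (rule bexI)
  qed
  then show "\<exists>B\<in>H. \<exists>i\<in>{1..n}. \<forall>t\<in>finite_subsets B \<inter> \<T>. c t = i"
    using B(1) by (rule bexI)
qed

text \<open>Sets of one finite size form a thin family, since none is properly included in
  another.\<close>

lemma NW_imp_arrow:
  assumes NW: "NW_Omega X enum" and k: "k \<ge> 1"
  shows "arrow_hom (omega_covers X) (omega_covers X) n k"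
  unfolding arrow_hom_def
proof (intro ballI allI impI)
  fix A' :: "'a set set" and f :: "'a set set \<Rightarrow> nat"
  assume A': "A' \<in> omega_covers X" and f: "\<forall>Y\<in>[A']\<^bsup>n\<^esup>. f Y \<in> {1..k}"
  obtain A where A: "A \<subseteq> A'" "A \<in> omega_covers X" "countable A" using ctbl A' by blast
  have "[A]\<^bsup>n\<^esup> \<subseteq> finite_subsets A" by (auto simp: finite_subsets_def nsets_def)
  moreover have "thin enum A ([A]\<^bsup>n\<^esup>)"
    unfolding thin_def initial_segment_def
  proof (intro ballI impI notI, elim conjE)
    fix s t assume "s \<in> [A]\<^bsup>n\<^esup>" "t \<in> [A]\<^bsup>n\<^esup>" "s \<subseteq> t" "s \<noteq> t"
    then show False using card_subset_eq[of t s] by (simp add: nsets_def)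
  qed
  moreover have "\<forall>Y\<in>[A]\<^bsup>n\<^esup>. f Y \<in> {1..k}" using f nsets_mono[OF A(1)] by blast
  ultimately have "\<exists>B\<in>ctbl_inf_subsets A \<inter> omega_covers X. \<exists>i\<in>{1..k}. \<forall>t\<in>finite_subsets B \<inter> [A]\<^bsup>n\<^esup>. f t = i"
    using NW[unfolded NW_Omega_def, rule_format, of A "[A]\<^bsup>n\<^esup>" k f] A k omega_cover_infinite[OF A(2)] by simp
  then obtain B i where B: "B \<in> ctbl_inf_subsets A \<inter> omega_covers X" "i \<in> {1..k}"
    "\<forall>t\<in>finite_subsets B \<inter> [A]\<^bsup>n\<^esup>. f t = i"
    by (elim bexE)
  have BA: "B \<subseteq> A" using B(1) by (auto simp: ctbl_inf_subsets_def)
  have "[B]\<^bsup>n\<^esup> \<subseteq> finite_subsets B \<inter> [A]\<^bsup>n\<^esup>"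
    using BA by (auto simp: finite_subsets_def nsets_def)
  then have "\<forall>Y\<in>[B]\<^bsup>n\<^esup>. f Y = i" using B(3) by blast
  then show "\<exists>i\<in>{1..k}. \<exists>B\<subseteq>A'. B \<in> omega_covers X \<and> (\<forall>Y\<in>[B]\<^bsup>n\<^esup>. f Y = i)"
    using B(1,2) BA A(1) by blast
qed

end

lemma arrow_hom_imp_arrow_sq:
  assumes "arrow_hom \<A> \<B> n k" "l \<ge> 1" shows "arrow_sq \<A> \<B> n k l"
  unfolding arrow_sq_def
proof (intro ballI allI impI)
  fix A and f :: "'a set \<Rightarrow> nat" assume A: "A \<in> \<A>" and f: "\<forall>Y\<in>[A]\<^bsup>n\<^esup>. f Y \<in> {1..k}"
  obtain i B where B: "B \<subseteq> A" "B \<in> \<B>" "\<forall>Y\<in>[B]\<^bsup>n\<^esup>. f Y = i"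
    by (rule arrow_homE[OF assms(1) A f])
  then have "f ` [B]\<^bsup>n\<^esup> \<subseteq> {i}" by blast
  then have "card (f ` [B]\<^bsup>n\<^esup>) \<le> 1" using card_mono[of "{i}" "f ` [B]\<^bsup>n\<^esup>"] by simp
  then show "\<exists>B\<subseteq>A. B \<in> \<B> \<and> card (f ` [B]\<^bsup>n\<^esup>) \<le> l" using B assms(2) by (meson order_trans)
qed

text \<open>Homogeneity passes to subsets, so the target for colour 2 need only be found inside
  members of \<open>\<B>\<close>; this covers both four-element sets and open covers.\<close>

lemma arrow_hom_imp_arrow_two:
  assumes arrow: "arrow_hom \<A> \<B> n 2" and sub: "\<And>B. B \<in> \<B> \<Longrightarrow> \<exists>C\<subseteq>B. C \<in> \<C>"
  shows "arrow_two \<A> \<B> \<C> n"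
  unfolding arrow_two_def
proof (intro ballI allI impI)
  fix A and f :: "'a set \<Rightarrow> nat" assume A: "A \<in> \<A>" "\<forall>Y\<in>[A]\<^bsup>n\<^esup>. f Y \<in> {1,2}"
  have f12: "\<forall>Y\<in>[A]\<^bsup>n\<^esup>. f Y \<in> {1..2}" using A(2) by force
  obtain i B where B: "i \<in> {1..2}" "B \<subseteq> A" "B \<in> \<B>" "\<forall>Y\<in>[B]\<^bsup>n\<^esup>. f Y = i"
    by (rule arrow_homE[OF arrow A(1) f12])
  obtain C where C: "C \<subseteq> B" "C \<in> \<C>" using sub B(3) by blast
  consider "i = 1" | "i = 2" using B(1) by fastforce
  then show "\<exists>B\<subseteq>A. B \<in> \<B> \<and> (\<forall>Y\<in>[B]\<^bsup>n\<^esup>. f Y = 1) \<or> B \<in> \<C> \<and> (\<forall>Y\<in>[B]\<^bsup>n\<^esup>. f Y = 2)"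
  proof cases
    case 1
    then show ?thesis using B by blast
  next
    case 2
    have "\<forall>Y\<in>[C]\<^bsup>n\<^esup>. f Y = 2" using B(4) 2 nsets_mono[OF C(1)] by blast
    moreover have "C \<subseteq> A" using C B(2) by blast
    ultimately show ?thesis using C by blast
  qed
qed

theorem theorem7p2:
  fixes X :: "'a topology" and enum :: "'a set set \<Rightarrow> nat \<Rightarrow> 'a set"
  assumes haus: "Hausdorff_space X"
    and ctbl: "\<forall>U\<in>omega_covers X. \<exists>V. V \<subseteq> U \<and> countable V \<and> V \<in> omega_covers X"
    and enum: "\<forall>A. countable A \<and> infinite A \<longrightarrow> bij_betw (enum A) UNIV A"
  shows
    "(S1 (omega_covers X) (omega_covers X) \<longleftrightarrow> E_Omega X enum) \<and>
     (S1 (omega_covers X) (omega_covers X) \<longleftrightarrow> GP_Omega X) \<and>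
     (S1 (omega_covers X) (omega_covers X) \<longleftrightarrow> FG_Omega X enum) \<and>
     (S1 (omega_covers X) (omega_covers X) \<longleftrightarrow> NW_Omega X enum) \<and>
     (S1 (omega_covers X) (omega_covers X) \<longleftrightarrow>
        (\<forall>n k. n \<ge> 1 \<and> k \<ge> 1 \<longrightarrow> arrow_hom (omega_covers X) (omega_covers X) n k)) \<and>
     (S1 (omega_covers X) (omega_covers X) \<longleftrightarrow>
        (\<forall>n k. n \<ge> 1 \<and> k \<ge> 1 \<longrightarrow> arrow_sq (omega_covers X) (omega_covers X) n k 2)) \<and>
     (S1 (omega_covers X) (omega_covers X) \<longleftrightarrow> arrow_sq (omega_covers X) (omega_covers X) 2 3 2) \<and>
     (S1 (omega_covers X) (omega_covers X) \<longleftrightarrow>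
        arrow_two (omega_covers X) (omega_covers X) {B. finite B \<and> card B = 4} 3) \<and>
     (S1 (omega_covers X) (omega_covers X) \<longleftrightarrow> arrow_hom (omega_covers X) (omega_covers X) 2 2) \<and>
     (S1 (omega_covers X) (omega_covers X) \<longleftrightarrow>
        arrow_two (omega_covers X) (omega_covers X) (open_covers X) 2)"
proof -
  let ?O = "omega_covers X"
  have E: "S1 ?O ?O \<Longrightarrow> E_Omega X enum" using S1_imp_E[OF ctbl enum] .
  have GP: "E_Omega X enum \<Longrightarrow> GP_Omega X" using E_imp_GP[OF ctbl enum] .
  have FG: "GP_Omega X \<Longrightarrow> FG_Omega X enum" using GP_imp_FG[OF ctbl enum] .
  have FGa: "FG_Omega X enum \<Longrightarrow> arrow_hom ?O ?O 2 2" using FG_imp_arrow[OF ctbl enum] .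
  have NW: "S1 ?O ?O \<Longrightarrow> NW_Omega X enum" using S1_imp_NW[OF ctbl enum] .
  have NWa: "NW_Omega X enum \<Longrightarrow> \<forall>n k. n \<ge> 1 \<and> k \<ge> 1 \<longrightarrow> arrow_hom ?O ?O n k"
    using NW_imp_arrow[OF ctbl enum] by blast
  have hom22: "\<forall>n k. n \<ge> 1 \<and> k \<ge> 1 \<longrightarrow> arrow_hom ?O ?O n k \<Longrightarrow> arrow_hom ?O ?O 2 2" by simp
  have sq: "\<forall>n k. n \<ge> 1 \<and> k \<ge> 1 \<longrightarrow> arrow_hom ?O ?O n k \<Longrightarrow> \<forall>n k. n \<ge> 1 \<and> k \<ge> 1 \<longrightarrow> arrow_sq ?O ?O n k 2"
    using arrow_hom_imp_arrow_sq[of ?O ?O _ _ 2] by simp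
  have sq23: "\<forall>n k. n \<ge> 1 \<and> k \<ge> 1 \<longrightarrow> arrow_sq ?O ?O n k 2 \<Longrightarrow> arrow_sq ?O ?O 2 3 2" by simp
  have four: "arrow_two ?O ?O {B. finite B \<and> card B = 4} 3"
    if "\<forall>n k. n \<ge> 1 \<and> k \<ge> 1 \<longrightarrow> arrow_hom ?O ?O n k"
  proof (rule arrow_hom_imp_arrow_two)
    show "arrow_hom ?O ?O 3 2" using that by simp
    fix B assume "B \<in> ?O"
    then show "\<exists>C\<subseteq>B. C \<in> {B. finite B \<and> card B = 4}"
      using infinite_arbitrarily_large[OF omega_cover_infinite, of B X 4] by blast
  qed
  have opn: "arrow_hom ?O ?O 2 2 \<Longrightarrow> arrow_two ?O ?O (open_covers X) 2"
    by (rule arrow_hom_imp_arrow_two) (auto simp: omega_covers_def open_covers_def)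
  note S1 = arrow_open_covers_imp_S1[OF ctbl] arrow_4_imp_S1[OF ctbl] arrow_sq_imp_S1[OF ctbl]
  \<comment> \<open>The cycles are \<open>S1\<close>, \<open>E_Omega\<close>,
    \<open>GP_Omega\<close>, \<open>FG_Omega\<close>, two-colour pairs, open covers,
    \<open>S1\<close>; and \<open>S1\<close>, \<open>NW_Omega\<close>, the full partition relation,
    from which the square-bracket and the four-element relations each lead back to
    \<open>S1\<close>.\<close>
  show ?thesis
    using E GP FG FGa NW NWa hom22 sq sq23 four opn S1 by argo
qed

end
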